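(* Let $\{q_n\}_{n=1}^{\infty}$ and $\{q'_n\}_{n=1}^{\infty}$ be two sequences of positive real numbers such that $\lim_{n\to\infty}n(1-q_n)=\beta$ and $\lim_{n\to\infty}n(1-q'_n)=\gamma$ with $\beta,\gamma\in\mathbb{R}$. Let $\mathbb{P}_n$ be the product probability measure on $S_n\times S_n$ given by $\mathbb{P}_n((\pi,\tau))=\mu_{n,q_n}(\pi)\cdot\mu_{n,q'_n}(\tau)$, and let $\tau\circ\pi$ denote the product in $S_n$, $\tau\circ\pi(i)=\tau(\pi(i))$. Then for every $\epsilon>0$ and every continuous function $f:[0,1]\times[0,1]\to\mathbb{R}$, $$\lim_{n\to\infty}\mathbb{P}_n\!\left(\left|\frac1n\sum_{i=1}^n f\!\left(\frac in,\frac{\tau\circ\pi(i)}{n}\right)-\int_0^1\!\int_0^1 f(x,y)\rho(x,y)\,dx\,dy\right|>\epsilon\right)=0,$$ where $$\rho(x,y):=\int_0^1 u(x,t,\beta)\,u(t,y,\gamma)\,dt.$$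
   Context: $[n]=\{1,\dots,n\}$ and $S_n$ is the symmetric group on $[n]$. For $\pi\in S_n$, $l(\pi)=|\{(i,j):1\le i<j\le n,\ \pi(i)>\pi(j)\}|$ is the number of inversions. For $q>0$ the Mallows measure on $S_n$ is the probability measure $\mu_{n,q}(\pi)=q^{l(\pi)}/Z_{n,q}$ with $Z_{n,q}=\sum_{\sigma\in S_n}q^{l(\sigma)}=\prod_{i=1}^n\frac{1-q^i}{1-q}$ (each factor read as $i$ when $q=1$). For $x,y\in[0,1]$ and $\beta\in\mathbb{R}$, $\beta\ne0$, $$u(x,y,\beta)=\frac{(\beta/2)\sinh(\beta/2)}{\left(e^{\beta/4}\cosh(\beta[x-y]/2)-e^{-\beta/4}\cosh(\beta[x+y-1]/2)\right)^2},$$ and $u(x,y,0):=1$. *)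

theory Defs
  imports "HOL-Probability.Probability" "HOL-Combinatorics.Permutations"
begin

definition inversions :: "nat \<Rightarrow> (nat \<Rightarrow> nat) \<Rightarrow> nat" where
  "inversions n p = card {(i, j). 1 \<le> i \<and> i < j \<and> j \<le> n \<and> p i > p j}"

definition mallows_Z :: "nat \<Rightarrow> real \<Rightarrow> real" where
  "mallows_Z n q = (\<Sum>p | p permutes {1..n}. q ^ inversions n p)"

text \<open>The symmetric group on \<open>{1..n}\<close> is represented by the functions on \<open>nat\<close> that permute
  \<open>{1..n}\<close> and fix everything else. The definition is meaningful for \<open>q > 0\<close> only; see
  \<open>pmf_mallows\<close> below.\<close>

definition mallows :: "nat \<Rightarrow> real \<Rightarrow> (nat \<Rightarrow> nat) pmf" where
  "mallows n q = embed_pmf (\<lambda>p.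
     if p permutes {1..n} then q ^ inversions n p / mallows_Z n q else 0)"

lemma mallows_Z_pos:
  assumes "q > 0"
  shows "mallows_Z n q > 0"
  unfolding mallows_Z_def
proof (rule sum_pos)
  show "finite {p. p permutes {1..n}}"
    by (simp add: finite_permutations)
  show "{p. p permutes {1..n}} \<noteq> {}"
    using permutes_id by blast
qed (use assms in simp)

lemma pmf_mallows:
  assumes "q > 0"
  shows "pmf (mallows n q) p =
    (if p permutes {1..n} then q ^ inversions n p / mallows_Z n q else 0)"
  unfolding mallows_def
proof (rule pmf_embed_pmf)
  let ?S = "{p. p permutes {1..n}}"
  let ?g = "\<lambda>p. q ^ inversions n p / mallows_Z n q"
  let ?f = "\<lambda>p. if p permutes {1..n} then ?g p else 0"
  have Z: "mallows_Z n q > 0"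
    by (rule mallows_Z_pos[OF assms])
  show "0 \<le> ?f p" for p
    using assms Z by simp
  have fin: "finite ?S"
    by (simp add: finite_permutations)
  have "(\<integral>\<^sup>+ p. ennreal (?f p) \<partial>count_space UNIV) = (\<Sum>p\<in>?S. ennreal (?f p))"
    by (rule nn_integral_count_space'[OF fin]) auto
  also have "\<dots> = (\<Sum>p\<in>?S. ennreal (?g p))"
    by (rule sum.cong) auto
  also have "\<dots> = ennreal (\<Sum>p\<in>?S. ?g p)"
    using assms Z by (intro sum_ennreal) simp
  also have "(\<Sum>p\<in>?S. ?g p) = 1"
    using Z by (simp add: sum_divide_distrib[symmetric] mallows_Z_def)
  finally show "(\<integral>\<^sup>+ p. ennreal (?f p) \<partial>count_space UNIV) = 1"
    by simp
qed

definition mallows_u :: "real \<Rightarrow> real \<Rightarrow> real \<Rightarrow> real" where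
  "mallows_u x y \<beta> =
     (if \<beta> = 0 then 1
      else (\<beta> / 2) * sinh (\<beta> / 2) /
        (exp (\<beta> / 4) * cosh (\<beta> * (x - y) / 2) -
         exp (- \<beta> / 4) * cosh (\<beta> * (x + y - 1) / 2))\<^sup>2)"

definition mallows_rho :: "real \<Rightarrow> real \<Rightarrow> real \<Rightarrow> real \<Rightarrow> real" where
  "mallows_rho \<beta> \<gamma> x y = integral {0..1} (\<lambda>t. mallows_u x t \<beta> * mallows_u t y \<gamma>)"

end

theory Submission
  imports Defs "HOL-Real_Asymp.Real_Asymp"
begin

text \<open>
  Reveal a Mallows permutation \<open>p\<close> from left to right. Exchanging two neighbouring unused values
  changes the number of inversions by exactly one, so the rank of \<open>p i\<close> among the \<open>k = n - i + 1\<close>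
  unused values is a truncated geometric variable, independent of the past. Hence the conditional
  probability of \<open>p i \<le> m\<close> is \<open>[R] / [k]\<close>, where \<open>R\<close> counts the unused values up to \<open>m\<close> and
  \<open>[k] = 1 + q + \<dots> + q ^ (k - 1)\<close> (lemma \<open>mallows_E_le\<close>).

  The count \<open>R\<close> is a Markov chain, and the function \<open>[R] / q ^ R\<close> of it has a conditional mean
  that is a constant multiple of its current value. Its mean is therefore an explicit telescoping product
  (\<open>mallows_E_qweight\<close>), and its variance grows by a bounded amount per step
  (\<open>variance_qweight_le\<close>), whereas its values are of order \<open>n\<close>. So the conditional distribution
  function of \<open>p i\<close> is close to a deterministic one. With \<open>b = - n * ln q\<close> the latter equals, for
  every \<open>n\<close>, the integral up to \<open>m / n\<close> of the density \<open>u\<close> with parameter \<open>b\<close> at relative position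
  \<open>(i - 1) / n\<close> (\<open>typical_cdf_eq_mallows_cdf\<close> and \<open>mallows_u_has_integral\<close>).

  Replacing each \<open>g i (p i)\<close> by its conditional mean costs a martingale, which is small after
  averaging, and replacing conditional means by deterministic ones costs what was just estimated
  (\<open>mallows_LLN\<close>). This gives a law of large numbers for sums of \<open>f (x j, p j / n)\<close> which is
  uniform in the coordinates \<open>x j\<close>, first for polynomials and then for continuous \<open>f\<close>
  (\<open>mallows_LLN_continuous\<close>).

  For the composition, the permutons of the two factors alone would not determine the limit;
  the uniformity does. Fixing \<open>\<pi>\<close> and applying the law to \<open>\<tau>\<close> averages
  \<open>f (i / n, \<tau> (\<pi> i) / n)\<close> over the density of \<open>\<tau>\<close> at relative position \<open>\<pi> i / n\<close>; this is a continuous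
  function of \<open>(i / n, \<pi> i / n)\<close>, to which the law for \<open>\<pi>\<close> applies. A Riemann sum and
  Fubini's theorem produce the integral of \<open>f\<close> against \<open>\<rho>\<close> (\<open>composed_mallows_LLN\<close>).
\<close>

section \<open>Lehmer codes and unused values\<close>

text \<open>Functions of the first \<open>i - 1\<close> values of a permutation: the finite substitute for measurability
with respect to the \<open>\<sigma>\<close>-algebra of the past. Position 0 may be included because permutations of
\<open>{1..n}\<close> fix it.\<close>

definition depends_before :: "nat \<Rightarrow> ((nat \<Rightarrow> nat) \<Rightarrow> real) \<Rightarrow> bool" where
  "depends_before i \<psi> \<longleftrightarrow> (\<forall>p p'. (\<forall>j<i. p j = p' j) \<longrightarrow> \<psi> p = \<psi> p')"

definition lehmer :: "nat \<Rightarrow> nat \<Rightarrow> (nat \<Rightarrow> nat) \<Rightarrow> nat" where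
  "lehmer n i p = card {j \<in> {i<..n}. p j < p i}"

text \<open>This is the number of values in \<open>{1..m}\<close> not yet taken at positions before \<open>i\<close>. It is written
through the positions before \<open>i\<close> so that its dependence on the past alone is visible; for
permutations and \<open>m \<le> n\<close> the natural subtraction does not truncate.\<close>

definition left_below :: "nat \<Rightarrow> nat \<Rightarrow> (nat \<Rightarrow> nat) \<Rightarrow> nat" where
  "left_below i m p = m - card {j \<in> {1..<i}. p j \<le> m}"

definition unused :: "nat \<Rightarrow> nat \<Rightarrow> (nat \<Rightarrow> nat) \<Rightarrow> nat set" where
  "unused n i p = {1..n} - p ` {1..<i}"

lemma unused_eq_image:
  assumes "p permutes {1..n}" "1 \<le> i" "i \<le> Suc n"
  shows "unused n i p = p ` {i..n}"
proof -
  have inj: "inj p" using assms(1) permutes_inj by blast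
  have "{1..n} = {1..<i} \<union> {i..n}" using assms by auto
  then have "p ` {1..n} = p ` {1..<i} \<union> p ` {i..n}" by (metis image_Un)
  moreover have "p ` {1..n} = {1..n}" using assms(1) permutes_image by blast
  moreover have "p ` {1..<i} \<inter> p ` {i..n} = {}"
  proof (intro equals0I)
    fix v assume "v \<in> p ` {1..<i} \<inter> p ` {i..n}"
    then obtain a b where "v = p a" "v = p b" "a \<in> {1..<i}" "b \<in> {i..n}" by blast
    then have "a = b" using inj by (simp add: inj_eq)
    then show False using \<open>a \<in> {1..<i}\<close> \<open>b \<in> {i..n}\<close> by simp
  qed
  ultimately show ?thesis unfolding unused_def by (metis Diff_triv Un_Diff Diff_cancel inf_commute sup_bot_left)
qed

lemma card_unused:
  assumes "p permutes {1..n}" "1 \<le> i" "i \<le> Suc n"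
  shows "card (unused n i p) = Suc n - i"
proof -
  have "inj p" using assms(1) permutes_inj by blast
  then have "card (p ` {i..n}) = card {i..n}" by (meson card_image inj_on_subset top_greatest)
  then show ?thesis using unused_eq_image[OF assms] by simp
qed

lemma lehmer_eq_rank:
  assumes "p permutes {1..n}" "1 \<le> i" "i \<le> n"
  shows "lehmer n i p = card {v \<in> unused n i p. v < p i}"
proof -
  have inj: "inj p" using assms(1) permutes_inj by blast
  have "{v \<in> unused n i p. v < p i} = p ` {j \<in> {i<..n}. p j < p i}"
  proof (intro set_eqI iffI)
    fix v assume "v \<in> {v \<in> unused n i p. v < p i}"
    then obtain j where j: "v = p j" "j \<in> {i..n}" "p j < p i"
      using unused_eq_image[of p n i] assms by auto
    then have "j \<noteq> i" by auto
    then show "v \<in> p ` {j \<in> {i<..n}. p j < p i}" using j by auto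
  next
    fix v assume "v \<in> p ` {j \<in> {i<..n}. p j < p i}"
    then show "v \<in> {v \<in> unused n i p. v < p i}"
      using unused_eq_image[of p n i] assms by auto
  qed
  moreover have "card (p ` {j \<in> {i<..n}. p j < p i}) = card {j \<in> {i<..n}. p j < p i}"
    by (meson card_image inj inj_on_subset top_greatest)
  ultimately show ?thesis unfolding lehmer_def by simp
qed

lemma left_below_eq_card:
  assumes "p permutes {1..n}" "1 \<le> i" "i \<le> Suc n" "m \<le> n"
  shows "left_below i m p = card {v \<in> unused n i p. v \<le> m}"
proof -
  have inj: "inj p" using assms(1) permutes_inj by blast
  have r: "p j \<in> {1..n}" if "j \<in> {1..<i}" for j
    using that assms permutes_in_image[OF assms(1), of j] by auto
  have "{v \<in> unused n i p. v \<le> m} = {1..m} - p ` {j \<in> {1..<i}. p j \<le> m}"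
    using assms unfolding unused_def by auto
  moreover have "card ({1..m} - p ` {j \<in> {1..<i}. p j \<le> m})
      = card {1..m} - card (p ` {j \<in> {1..<i}. p j \<le> m})"
    using r by (intro card_Diff_subset) fastforce+
  moreover have "card (p ` {j \<in> {1..<i}. p j \<le> m}) = card {j \<in> {1..<i}. p j \<le> m}"
    by (meson card_image inj inj_on_subset top_greatest)
  ultimately show ?thesis unfolding left_below_def by simp
qed

text \<open>The entry \<open>lehmer n i p\<close> of the Lehmer code is the rank of \<open>p i\<close> among the unused values, and
\<open>left_below i m p\<close> counts the unused values up to \<open>m\<close>. So, given the past, the event \<open>p i \<le> m\<close>
is an event about one entry of the Lehmer code.\<close>

lemma le_iff_lehmer_less:
  assumes "p permutes {1..n}" "1 \<le> i" "i \<le> n" "m \<le> n"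
  shows "p i \<le> m \<longleftrightarrow> lehmer n i p < left_below i m p"
proof -
  let ?S = "unused n i p"
  have fin: "finite ?S" unfolding unused_def by simp
  have pi: "p i \<in> ?S" using unused_eq_image[of p n i] assms by auto
  have eq: "lehmer n i p = card {v \<in> ?S. v < p i}" "left_below i m p = card {v \<in> ?S. v \<le> m}"
    using lehmer_eq_rank left_below_eq_card assms by simp_all
  show ?thesis
  proof (cases "p i \<le> m")
    case True
    have "card {v \<in> ?S. v < p i} < card {v \<in> ?S. v \<le> m}"
      using fin pi True by (intro psubset_card_mono) auto
    then show ?thesis using True eq by simp
  next
    case False
    have "card {v \<in> ?S. v \<le> m} \<le> card {v \<in> ?S. v < p i}"
      using fin False by (intro card_mono) auto
    then show ?thesis using False eq by simp
  qed
qed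

lemma left_below_Suc:
  assumes "p permutes {1..n}" "1 \<le> i" "i \<le> n" "m \<le> n"
  shows "left_below (Suc i) m p = left_below i m p - (if p i \<le> m then 1 else 0)"
proof -
  have s: "{j \<in> {1..<Suc i}. p j \<le> m}
    = (if p i \<le> m then insert i {j \<in> {1..<i}. p j \<le> m} else {j \<in> {1..<i}. p j \<le> m})"
    using assms by (auto simp: less_Suc_eq)
  show ?thesis unfolding left_below_def s by (auto simp: card_insert_if)
qed

lemma left_below_le:
  assumes "p permutes {1..n}" "1 \<le> i" "i \<le> Suc n" "m \<le> n"
  shows "left_below i m p \<le> Suc n - i"
proof -
  have "finite (unused n i p)" unfolding unused_def by simp
  then have "card {v \<in> unused n i p. v \<le> m} \<le> card (unused n i p)"
    by (intro card_mono) auto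
  then show ?thesis using left_below_eq_card[OF assms] card_unused[of p n i] assms by simp
qed

lemma lehmer_le: "lehmer n i p \<le> n - i"
proof -
  have "card {j \<in> {i<..n}. p j < p i} \<le> card {i<..n}"
    by (intro card_mono) auto
  then show ?thesis unfolding lehmer_def by simp
qed

lemma left_below_first [simp]: "left_below (Suc 0) m p = m"
  unfolding left_below_def by simp

lemma left_below_full:
  assumes "p permutes {1..n}" "1 \<le> i" "i \<le> Suc n"
  shows "left_below i n p = Suc n - i"
proof -
  have "{v \<in> unused n i p. v \<le> n} = unused n i p" unfolding unused_def by auto
  then show ?thesis using left_below_eq_card[of p n i n] card_unused[of p n i] assms by simp
qed

lemma left_below_0 [simp]: "left_below i 0 p = 0"
  unfolding left_below_def by simp

text \<open>A position \<open>k > i\<close> other than \<open>j\<close> compares in the same way with both exchanged values,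
because its value lies outside the gap between them; a position left of \<open>i\<close> sees the two values exchanged,
so its comparisons with \<open>i\<close> and \<open>j\<close> trade places, which is the relabelling \<open>\<phi>\<close> of pairs below.
Only the pair \<open>(i, j)\<close> itself changes, from a non-inversion to an inversion.\<close>

lemma inversions_swap_adjacent:
  assumes p: "p permutes {1..n}" and ij: "1 \<le> i" "i < j" "j \<le> n" "p i < p j"
    and gap: "\<And>k. k \<in> {i..n} \<Longrightarrow> \<not> (p i < p k \<and> p k < p j)"
  shows "inversions n (Transposition.transpose (p i) (p j) \<circ> p) = Suc (inversions n p)"
proof -
  have inj: "inj p" using p permutes_inj by blast
  define p' where "p' = Transposition.transpose (p i) (p j) \<circ> p"
  have p': "p' i = p j" "p' j = p i" "\<And>k. k \<noteq> i \<Longrightarrow> k \<noteq> j \<Longrightarrow> p' k = p k"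
    using inj unfolding p'_def by (auto simp: Transposition.transpose_def inj_eq)
  define \<phi> where "\<phi> = (\<lambda>(a, b). if a < i then (a, Transposition.transpose i j b) else (a, b))"
  have inv\<phi>: "\<phi> (\<phi> z) = z" for z
    unfolding \<phi>_def by (auto split: prod.splits if_splits)
  then have inj\<phi>: "inj \<phi>" by (metis injI)
  let ?I = "\<lambda>p. {(a, b). 1 \<le> a \<and> a < b \<and> b \<le> n \<and> p a > p b}"
  have fin: "finite (?I p)"
    by (rule finite_subset[of _ "{..n} \<times> {..n}"]) auto
  have ne: "p a \<noteq> p b" if "a \<noteq> b" for a b using inj that by (simp add: inj_eq)
  have key: "\<phi> (a, b) \<in> ?I p' \<longleftrightarrow> (a, b) \<in> ?I p" if ab: "(a, b) \<noteq> (i, j)" for a b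
  proof (cases "1 \<le> a \<and> a < b \<and> b \<le> n")
    case False
    then show ?thesis using ij unfolding \<phi>_def by (auto simp: Transposition.transpose_def split: if_splits)
  next
    case True
    consider "a < i" | "a = i" | "a > i" by linarith
    then show ?thesis
    proof cases
      case 1
      then have "p' a = p a" "p' (Transposition.transpose i j b) = p b"
        using True ij p' by (auto simp: Transposition.transpose_def)
      moreover have "a < Transposition.transpose i j b \<and> Transposition.transpose i j b \<le> n"
        using 1 True ij by (auto simp: Transposition.transpose_def)
      ultimately show ?thesis using 1 True unfolding \<phi>_def by simp
    next
      case 2
      then have "b \<noteq> j" "b \<in> {i..n}" "b \<noteq> i" using ab True by auto
      then have "p b \<noteq> p j" "p b \<noteq> p i" "p' b = p b" using ne p'(3)[of b] by metis+
      then have "p j > p b \<longleftrightarrow> p i > p b" using gap[of b] \<open>b \<in> {i..n}\<close> ij by linarith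
      then show ?thesis using 2 True p' \<open>p' b = p b\<close> unfolding \<phi>_def by simp
    next
      case 3
      have ne': "a \<noteq> i" "b \<noteq> i" "a \<in> {i..n}" "b \<in> {i..n}" using 3 True by auto
      then have cmp: "c \<noteq> j \<Longrightarrow> c \<in> {i..n} \<Longrightarrow> c \<noteq> i \<Longrightarrow> p c < p j \<longleftrightarrow> p c < p i" for c
        using gap[of c] ne[of c j] ne[of c i] ij(4) by linarith
      have "p' a > p' b \<longleftrightarrow> p a > p b"
      proof (cases "a = j")
        case True
        then have "b \<noteq> j" using \<open>1 \<le> a \<and> a < b \<and> b \<le> n\<close> by simp
        then show ?thesis using True p'(2) p'(3)[of b] ne' cmp[of b] by simp
      next
        case False
        then have a: "p' a = p a" "p a \<noteq> p i" "p a \<noteq> p j" "p a < p j \<longleftrightarrow> p a < p i"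
          using p'(3)[of a] ne[of a i] ne[of a j] ne' cmp[of a] by simp_all
        show ?thesis
        proof (cases "b = j")
          case True
          then show ?thesis using a p'(2) by auto
        next
          case False
          then show ?thesis using a(1) p'(3)[of b] ne' by simp
        qed
      qed
      then show ?thesis using 3 True unfolding \<phi>_def by simp
    qed
  qed
  have "?I p' = insert (i, j) (\<phi> ` ?I p)"
  proof (intro set_eqI iffI)
    fix z assume z: "z \<in> ?I p'"
    obtain a b where ab: "\<phi> z = (a, b)" by fastforce
    then have zab: "z = \<phi> (a, b)" using inv\<phi> by metis
    show "z \<in> insert (i, j) (\<phi> ` ?I p)"
    proof (cases "(a, b) = (i, j)")
      case True
      then have "z = (i, j)" using zab unfolding \<phi>_def by simp
      then show ?thesis by simp
    next
      case False
      then have "(a, b) \<in> ?I p" using key[OF False] z zab by simp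
      then show ?thesis using zab by (intro insertI2 image_eqI)
    qed
  next
    fix z assume "z \<in> insert (i, j) (\<phi> ` ?I p)"
    then consider "z = (i, j)" | a b where "(a, b) \<in> ?I p" "z = \<phi> (a, b)" by auto
    then show "z \<in> ?I p'"
    proof cases
      case 1
      then show ?thesis using ij p' by auto
    next
      case 2
      then have "(a, b) \<noteq> (i, j)" using ij by auto
      then show ?thesis using iffD2[OF key 2(1)] 2(2) by simp
    qed
  qed
  moreover have "(i, j) \<notin> \<phi> ` ?I p"
  proof
    assume "(i, j) \<in> \<phi> ` ?I p"
    then obtain z where "z \<in> ?I p" "(i, j) = \<phi> z" by blast
    then have "\<phi> (i, j) \<in> ?I p" using inv\<phi> by metis
    then show False using ij unfolding \<phi>_def by auto
  qed
  moreover have "card (\<phi> ` ?I p) = card (?I p)"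
    by (meson card_image inj\<phi> inj_on_subset top_greatest)
  ultimately have "card (?I p') = Suc (card (?I p))" using fin by simp
  then show ?thesis unfolding inversions_def p'_def by simp
qed

lemma rank_bij_betw:
  fixes S :: "'a::linorder set"
  assumes "finite S"
  shows "bij_betw (\<lambda>v. card {w \<in> S. w < v}) S {..<card S}"
proof -
  let ?r = "\<lambda>v. card {w \<in> S. w < v}"
  have mono: "?r v < ?r w" if "v \<in> S" "w \<in> S" "v < w" for v w
    using assms that by (intro psubset_card_mono) auto
  have inj: "inj_on ?r S"
  proof (rule inj_onI)
    fix v w assume "v \<in> S" "w \<in> S" "?r v = ?r w"
    then show "v = w" using mono[of v w] mono[of w v] by (cases v w rule: linorder_cases) auto
  qed
  have "?r ` S \<subseteq> {..<card S}"
    using assms by (auto intro!: psubset_card_mono)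
  moreover have "card (?r ` S) = card {..<card S}" using inj by (simp add: card_image)
  ultimately have "?r ` S = {..<card S}" by (simp add: card_subset_eq)
  then show ?thesis using inj by (simp add: bij_betw_def)
qed

section \<open>The conditional law of the next value\<close>

text \<open>The Mallows measure lives on a finite set, so the expectation can be taken as a finite sum; linearity,
monotonicity and reindexing by bijections are then facts about sums.\<close>

definition mallows_E :: "nat \<Rightarrow> real \<Rightarrow> ((nat \<Rightarrow> nat) \<Rightarrow> real) \<Rightarrow> real" where
  "mallows_E n q X = (\<Sum>p | p permutes {1..n}. pmf (mallows n q) p * X p)"

definition nth_unused :: "nat \<Rightarrow> nat \<Rightarrow> (nat \<Rightarrow> nat) \<Rightarrow> nat \<Rightarrow> nat" where
  "nth_unused n i p = inv_into (unused n i p) (\<lambda>v. card {w \<in> unused n i p. w < v})"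

text \<open>Exchanges the unused values of ranks \<open>r\<close> and \<open>r + 1\<close>. Both are unused at the positions before \<open>i\<close>, so
the past stays fixed, and with it the two exchanged values; hence the map is an involution on
permutations. It interchanges the events \<open>lehmer n i p = r\<close> and \<open>lehmer n i p = Suc r\<close>.\<close>

definition next_lehmer :: "nat \<Rightarrow> nat \<Rightarrow> nat \<Rightarrow> (nat \<Rightarrow> nat) \<Rightarrow> nat \<Rightarrow> nat" where
  "next_lehmer n i r p =
     Transposition.transpose (nth_unused n i p r) (nth_unused n i p (Suc r)) \<circ> p"

lemma finite_unused [simp]: "finite (unused n i p)"
  unfolding unused_def by simp

lemma nth_unused:
  assumes "r < card (unused n i p)"
  shows "nth_unused n i p r \<in> unused n i p"
    and "card {w \<in> unused n i p. w < nth_unused n i p r} = r"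
proof -
  have b: "bij_betw (\<lambda>v. card {w \<in> unused n i p. w < v}) (unused n i p) {..<card (unused n i p)}"
    by (rule rank_bij_betw) simp
  have r: "r \<in> (\<lambda>v. card {w \<in> unused n i p. w < v}) ` unused n i p"
    using bij_betw_imp_surj_on[OF b] assms by simp
  show "nth_unused n i p r \<in> unused n i p"
    unfolding nth_unused_def by (rule inv_into_into[OF r])
  show "card {w \<in> unused n i p. w < nth_unused n i p r} = r"
    unfolding nth_unused_def by (rule f_inv_into_f[OF r])
qed

lemma rank_less_iff:
  fixes v w :: "'a::linorder"
  assumes "finite S" "v \<in> S" "w \<in> S"
  shows "card {x \<in> S. x < v} < card {x \<in> S. x < w} \<longleftrightarrow> v < w"
proof
  assume "v < w"
  then show "card {x \<in> S. x < v} < card {x \<in> S. x < w}"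
    using assms by (intro psubset_card_mono) auto
next
  assume *: "card {x \<in> S. x < v} < card {x \<in> S. x < w}"
  show "v < w"
  proof (rule ccontr)
    assume "\<not> v < w"
    then have "card {x \<in> S. x < w} \<le> card {x \<in> S. x < v}"
      using assms by (intro card_mono) auto
    then show False using * by simp
  qed
qed

lemma lehmer_eq_iff:
  assumes "p permutes {1..n}" "1 \<le> i" "i \<le> n" "r \<le> n - i"
  shows "lehmer n i p = r \<longleftrightarrow> p i = nth_unused n i p r"
proof -
  have c: "r < card (unused n i p)" using card_unused[of p n i] assms by simp
  have pi: "p i \<in> unused n i p" using unused_eq_image[of p n i] assms by simp
  have l: "lehmer n i p = card {w \<in> unused n i p. w < p i}" using lehmer_eq_rank assms by simp
  note s = nth_unused[OF c]
  show ?thesis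
  proof
    assume "p i = nth_unused n i p r"
    then show "lehmer n i p = r" using l s(2) by simp
  next
    assume "lehmer n i p = r"
    then have "\<not> p i < nth_unused n i p r" "\<not> nth_unused n i p r < p i"
      using rank_less_iff[OF finite_unused pi s(1)] rank_less_iff[OF finite_unused s(1) pi] l s(2)
      by simp_all
    then show "p i = nth_unused n i p r" by simp
  qed
qed

lemma next_lehmer_prefix:
  assumes p: "p permutes {1..n}" and i: "1 \<le> i" "i \<le> n" "Suc r \<le> n - i" and j: "j < i"
  shows "next_lehmer n i r p j = p j"
proof -
  have c: "Suc r < card (unused n i p)" using card_unused[of p n i] p i by simp
  have "p j \<notin> unused n i p"
  proof (cases "j = 0")
    case True
    then have "p j = 0" using p by (simp add: permutes_def)
    then show ?thesis unfolding unused_def by simp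
  next
    case False
    then show ?thesis using j unfolding unused_def by simp
  qed
  then have "p j \<noteq> nth_unused n i p r" "p j \<noteq> nth_unused n i p (Suc r)"
    using nth_unused(1)[of r n i p] nth_unused(1)[of "Suc r" n i p] c by auto
  then show ?thesis unfolding next_lehmer_def by simp
qed

lemma unused_next_lehmer:
  assumes "p permutes {1..n}" "1 \<le> i" "i \<le> n" "Suc r \<le> n - i"
  shows "unused n i (next_lehmer n i r p) = unused n i p"
proof -
  have "next_lehmer n i r p ` {1..<i} = p ` {1..<i}"
    using next_lehmer_prefix[OF assms] by (intro image_cong) auto
  then show ?thesis unfolding unused_def by simp
qed

lemma next_lehmer_involution:
  assumes "p permutes {1..n}" "1 \<le> i" "i \<le> n" "Suc r \<le> n - i"
  shows "next_lehmer n i r (next_lehmer n i r p) = p"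
proof -
  have "nth_unused n i (next_lehmer n i r p) = nth_unused n i p"
    unfolding nth_unused_def unused_next_lehmer[OF assms] ..
  then show ?thesis
    by (subst next_lehmer_def) (simp add: next_lehmer_def o_assoc)
qed

lemma next_lehmer_permutes:
  assumes p: "p permutes {1..n}" and i: "1 \<le> i" "i \<le> n" "Suc r \<le> n - i"
  shows "next_lehmer n i r p permutes {1..n}"
proof -
  have c: "Suc r < card (unused n i p)" using card_unused[of p n i] p i by simp
  have "nth_unused n i p r \<in> {1..n}" "nth_unused n i p (Suc r) \<in> {1..n}"
    using nth_unused(1)[of r n i p] nth_unused(1)[of "Suc r" n i p] c unfolding unused_def by auto
  then show ?thesis
    unfolding next_lehmer_def by (intro permutes_compose[OF p] permutes_swap_id)
qed

lemma lehmer_next_lehmer: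
  assumes p: "p permutes {1..n}" and i: "1 \<le> i" "i \<le> n" "Suc r \<le> n - i"
  shows "lehmer n i p = r \<Longrightarrow> lehmer n i (next_lehmer n i r p) = Suc r"
    and "lehmer n i p = Suc r \<Longrightarrow> lehmer n i (next_lehmer n i r p) = r"
proof -
  note p' = next_lehmer_permutes[OF assms]
  have s: "nth_unused n i (next_lehmer n i r p) = nth_unused n i p"
    unfolding nth_unused_def unused_next_lehmer[OF assms] ..
  show "lehmer n i p = r \<Longrightarrow> lehmer n i (next_lehmer n i r p) = Suc r"
    using lehmer_eq_iff[OF p i(1,2), of r] lehmer_eq_iff[OF p' i(1,2), of "Suc r"] i s
    by (simp add: next_lehmer_def)
  show "lehmer n i p = Suc r \<Longrightarrow> lehmer n i (next_lehmer n i r p) = r"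
    using lehmer_eq_iff[OF p i(1,2), of "Suc r"] lehmer_eq_iff[OF p' i(1,2), of r] i s
    by (simp add: next_lehmer_def)
qed

lemma inversions_next_lehmer:
  assumes p: "p permutes {1..n}" and i: "1 \<le> i" "i \<le> n" "Suc r \<le> n - i"
    and l: "lehmer n i p = r"
  shows "inversions n (next_lehmer n i r p) = Suc (inversions n p)"
proof -
  let ?S = "unused n i p"
  have c: "Suc r < card ?S" using card_unused[of p n i] p i by simp
  have c': "r < card ?S" using c by simp
  note s = nth_unused[OF c'] and s' = nth_unused[OF c]
  have S: "?S = p ` {i..n}" using unused_eq_image[of p n i] p i by simp
  have pi: "p i = nth_unused n i p r" using lehmer_eq_iff[OF p i(1,2), of r] l i by simp
  obtain j where j: "j \<in> {i..n}" "nth_unused n i p (Suc r) = p j" using s'(1) S by auto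
  have lt: "p i < p j"
    using rank_less_iff[OF finite_unused s(1) s'(1)] s(2) s'(2) pi j by simp
  then have ij: "i < j" using j by (cases "i = j") auto
  have "inversions n (Transposition.transpose (p i) (p j) \<circ> p) = Suc (inversions n p)"
  proof (rule inversions_swap_adjacent[OF p])
    fix k assume "k \<in> {i..n}"
    then have "p k \<in> ?S" using S by simp
    then have "r < card {x \<in> ?S. x < p k} \<longleftrightarrow> p i < p k"
      "card {x \<in> ?S. x < p k} < Suc r \<longleftrightarrow> p k < p j"
      using rank_less_iff[OF finite_unused s(1), of "p k"]
        rank_less_iff[OF finite_unused _ s'(1), of "p k"] s(2) s'(2) pi j by simp_all
    then show "\<not> (p i < p k \<and> p k < p j)" by linarith
  qed (use i ij j lt in auto)
  then show ?thesis unfolding next_lehmer_def pi[symmetric] j(2) .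
qed

text \<open>Given the past, the Lehmer code entry is a truncated geometric variable: the involution
\<open>next_lehmer\<close> is a bijection between the two events that adds one inversion, that is a factor
\<open>q\<close>, and leaves functions of the past unchanged.\<close>

lemma mallows_E_lehmer_Suc:
  assumes q: "q > 0" and i: "1 \<le> i" "i \<le> n" "Suc r \<le> n - i" and \<psi>: "depends_before i \<psi>"
  shows "mallows_E n q (\<lambda>p. of_bool (lehmer n i p = Suc r) * \<psi> p)
       = q * mallows_E n q (\<lambda>p. of_bool (lehmer n i p = r) * \<psi> p)"
proof -
  let ?P = "{p. p permutes {1..n}}"
  let ?w = "pmf (mallows n q)" and ?T = "next_lehmer n i r"
  have fin: "finite ?P" by (simp add: finite_permutations)
  have *: "mallows_E n q (\<lambda>p. of_bool (lehmer n i p = k) * \<psi> p)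
      = (\<Sum>p | p permutes {1..n} \<and> lehmer n i p = k. ?w p * \<psi> p)" for k
    unfolding mallows_E_def using fin by (intro sum.mono_neutral_cong_right) auto
  have "(\<Sum>p | p permutes {1..n} \<and> lehmer n i p = Suc r. ?w p * \<psi> p)
      = (\<Sum>p | p permutes {1..n} \<and> lehmer n i p = r. q * (?w p * \<psi> p))"
  proof (rule sum.reindex_bij_witness[where i = ?T and j = ?T])
    fix p assume "p \<in> {p. p permutes {1..n} \<and> lehmer n i p = Suc r}"
    then have p: "p permutes {1..n}" and l: "lehmer n i p = Suc r" by auto
    note T = next_lehmer_permutes[OF p i] next_lehmer_involution[OF p i]
      lehmer_next_lehmer(2)[OF p i l]
    show "?T (?T p) = p" "?T p \<in> {p. p permutes {1..n} \<and> lehmer n i p = r}" using T by auto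
    have "inversions n p = Suc (inversions n (?T p))"
      using inversions_next_lehmer[OF T(1) i T(3)] T(2) by simp
    then have "?w p = q * ?w (?T p)" using p T(1) q by (simp add: pmf_mallows)
    moreover have "\<psi> (?T p) = \<psi> p"
      using \<psi> next_lehmer_prefix[OF p i] unfolding depends_before_def by blast
    ultimately show "q * (?w (?T p) * \<psi> (?T p)) = ?w p * \<psi> p" by simp
  next
    fix p assume "p \<in> {p. p permutes {1..n} \<and> lehmer n i p = r}"
    then have p: "p permutes {1..n}" and l: "lehmer n i p = r" by auto
    show "?T (?T p) = p" "?T p \<in> {p. p permutes {1..n} \<and> lehmer n i p = Suc r}"
      using next_lehmer_permutes[OF p i] next_lehmer_involution[OF p i]
        lehmer_next_lehmer(1)[OF p i l] by auto
  qed
  then show ?thesis unfolding * by (simp add: sum_distrib_left)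
qed

text \<open>The \<open>q\<close>-integer \<open>[k] = 1 + q + \<dots> + q ^ (k - 1)\<close>, kept as a sum so that \<open>q = 1\<close> is
an ordinary value.\<close>

definition qnum :: "real \<Rightarrow> nat \<Rightarrow> real" where
  "qnum q k = (\<Sum>j<k. q ^ j)"

lemma depends_before_mult:
  "depends_before i \<psi> \<Longrightarrow> depends_before i \<theta> \<Longrightarrow> depends_before i (\<lambda>p. \<psi> p * \<theta> p)"
  unfolding depends_before_def by metis

lemma depends_before_left_below: "depends_before i (\<lambda>p. F (left_below i m p))"
  unfolding depends_before_def
proof (intro allI impI)
  fix p p' :: "nat \<Rightarrow> nat" assume "\<forall>j<i. p j = p' j"
  then have "{j \<in> {1..<i}. p j \<le> m} = {j \<in> {1..<i}. p' j \<le> m}" by auto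
  then show "F (left_below i m p) = F (left_below i m p')" unfolding left_below_def by simp
qed

lemma mallows_E_cong:
  "(\<And>p. p permutes {1..n} \<Longrightarrow> X p = Y p) \<Longrightarrow> mallows_E n q X = mallows_E n q Y"
  unfolding mallows_E_def by (intro sum.cong) auto

lemma mallows_E_sum: "mallows_E n q (\<lambda>p. \<Sum>a\<in>A. X a p) = (\<Sum>a\<in>A. mallows_E n q (X a))"
  unfolding mallows_E_def by (simp add: sum_distrib_left) (rule sum.swap)

lemma mallows_E_cmult: "mallows_E n q (\<lambda>p. c * X p) = c * mallows_E n q X"
  unfolding mallows_E_def by (simp add: sum_distrib_left mult_ac)

lemma mallows_E_add: "mallows_E n q (\<lambda>p. X p + Y p) = mallows_E n q X + mallows_E n q Y"
  unfolding mallows_E_def by (simp add: distrib_left sum.distrib)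

lemma mallows_E_diff: "mallows_E n q (\<lambda>p. X p - Y p) = mallows_E n q X - mallows_E n q Y"
  unfolding mallows_E_def by (simp add: right_diff_distrib sum_subtractf)

lemma mallows_E_mono:
  "(\<And>p. p permutes {1..n} \<Longrightarrow> X p \<le> Y p) \<Longrightarrow> mallows_E n q X \<le> mallows_E n q Y"
  unfolding mallows_E_def by (intro sum_mono mult_left_mono) auto

lemma mallows_E_const:
  assumes "q > 0"
  shows "mallows_E n q (\<lambda>p. c) = c"
proof -
  have "(\<Sum>p | p permutes {1..n}. pmf (mallows n q) p) = 1"
    using assms by (intro sum_pmf_eq_1) (auto simp: finite_permutations set_pmf_iff pmf_mallows split: if_splits)
  then show ?thesis unfolding mallows_E_def by (simp add: sum_distrib_right[symmetric])
qed

lemma mallows_E_lehmer: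
  assumes q: "q > 0" and i: "1 \<le> i" "i \<le> n" "r \<le> n - i" and \<psi>: "depends_before i \<psi>"
  shows "mallows_E n q (\<lambda>p. of_bool (lehmer n i p = r) * \<psi> p)
       = q ^ r * mallows_E n q (\<lambda>p. of_bool (lehmer n i p = 0) * \<psi> p)"
  using i(3)
proof (induction r)
  case (Suc r)
  then show ?case using mallows_E_lehmer_Suc[OF q i(1,2) Suc.prems \<psi>] by simp
qed simp

text \<open>With \<open>[k] = qnum q k\<close>, \<open>R = left_below i m p\<close>, and \<open>k = n - i + 1\<close> unused values, this says that the
conditional probability of \<open>p i \<le> m\<close> given the past is \<open>[R] / [k]\<close>: sum the geometric weights of
the Lehmer code below \<open>R\<close>, respectively over its whole range.\<close>

lemma mallows_E_le:
  assumes q: "q > 0" and i: "1 \<le> i" "i \<le> n" and m: "m \<le> n" and \<psi>: "depends_before i \<psi>"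
  shows "qnum q (Suc n - i) * mallows_E n q (\<lambda>p. of_bool (p i \<le> m) * \<psi> p)
       = mallows_E n q (\<lambda>p. qnum q (left_below i m p) * \<psi> p)"
proof -
  have gen: "mallows_E n q (\<lambda>p. of_bool (lehmer n i p < left_below i m p) * \<psi> p)
    = mallows_E n q (\<lambda>p. of_bool (lehmer n i p = 0) * (qnum q (left_below i m p) * \<psi> p))"
    if \<psi>: "depends_before i \<psi>" and m: "m \<le> n" for \<psi> m
  proof -
    have "mallows_E n q (\<lambda>p. of_bool (lehmer n i p < left_below i m p) * \<psi> p)
      = mallows_E n q (\<lambda>p. \<Sum>r<Suc n - i. of_bool (lehmer n i p = r) *
          (of_bool (r < left_below i m p) * \<psi> p))"
    proof (rule mallows_E_cong)
      fix p assume "p permutes {1..n}"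
      have "(\<Sum>r<Suc n - i. of_bool (lehmer n i p = r) * (of_bool (r < left_below i m p) * \<psi> p))
        = (\<Sum>r<Suc n - i. if lehmer n i p = r then of_bool (r < left_below i m p) * \<psi> p else 0)"
        by (intro sum.cong) auto
      also have "\<dots> = of_bool (lehmer n i p < left_below i m p) * \<psi> p"
        using lehmer_le[of n i p] i by (subst sum.delta') auto
      finally show "of_bool (lehmer n i p < left_below i m p) * \<psi> p
        = (\<Sum>r<Suc n - i. of_bool (lehmer n i p = r) * (of_bool (r < left_below i m p) * \<psi> p))" ..
    qed
    also have "\<dots> = (\<Sum>r<Suc n - i. q ^ r *
       mallows_E n q (\<lambda>p. of_bool (lehmer n i p = 0) * (of_bool (r < left_below i m p) * \<psi> p)))"
      unfolding mallows_E_sum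
    proof (intro sum.cong refl mallows_E_lehmer q i)
      fix r show "depends_before i (\<lambda>p. of_bool (r < left_below i m p) * \<psi> p)"
        by (intro depends_before_mult \<psi> depends_before_left_below[of _ "\<lambda>x. of_bool (r < x)"])
    qed auto
    also have "\<dots> = mallows_E n q (\<lambda>p. \<Sum>r<Suc n - i. q ^ r *
       (of_bool (lehmer n i p = 0) * (of_bool (r < left_below i m p) * \<psi> p)))"
      unfolding mallows_E_sum mallows_E_cmult ..
    also have "\<dots> = mallows_E n q (\<lambda>p. of_bool (lehmer n i p = 0) * (qnum q (left_below i m p) * \<psi> p))"
    proof (rule mallows_E_cong)
      fix p assume p: "p permutes {1..n}"
      have le: "left_below i m p \<le> Suc n - i" using left_below_le[OF p] i m by simp
      have "qnum q (left_below i m p) = (\<Sum>r<Suc n - i. q ^ r * of_bool (r < left_below i m p))"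
        unfolding qnum_def using le by (intro sum.mono_neutral_cong_left) auto
      then show "(\<Sum>r<Suc n - i. q ^ r *
          (of_bool (lehmer n i p = 0) * (of_bool (r < left_below i m p) * \<psi> p)))
        = of_bool (lehmer n i p = 0) * (qnum q (left_below i m p) * \<psi> p)"
        by (simp only: sum_distrib_left sum_distrib_right mult_ac)
    qed
    finally show ?thesis .
  qed
  have full: "mallows_E n q \<theta> = qnum q (Suc n - i) * mallows_E n q (\<lambda>p. of_bool (lehmer n i p = 0) * \<theta> p)"
    if \<theta>: "depends_before i \<theta>" for \<theta>
  proof -
    have "mallows_E n q \<theta> = mallows_E n q (\<lambda>p. of_bool (lehmer n i p < left_below i n p) * \<theta> p)"
    proof (rule mallows_E_cong)
      fix p assume p: "p permutes {1..n}"
      then have "left_below i n p = Suc n - i" using left_below_full i by simp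
      then have "lehmer n i p < left_below i n p" using lehmer_le[of n i p] i by simp
      then show "\<theta> p = of_bool (lehmer n i p < left_below i n p) * \<theta> p" by simp
    qed
    also have "\<dots> = mallows_E n q
        (\<lambda>p. of_bool (lehmer n i p = 0) * (qnum q (left_below i n p) * \<theta> p))"
      by (rule gen[OF \<theta>]) simp
    also have "\<dots> = mallows_E n q (\<lambda>p. qnum q (Suc n - i) * (of_bool (lehmer n i p = 0) * \<theta> p))"
      using left_below_full i by (intro mallows_E_cong) simp
    finally show ?thesis by (simp add: mallows_E_cmult)
  qed
  have dep: "depends_before i (\<lambda>p. qnum q (left_below i m p) * \<psi> p)"
    by (intro depends_before_mult \<psi> depends_before_left_below[of _ "qnum q"])
  have "mallows_E n q (\<lambda>p. of_bool (p i \<le> m) * \<psi> p)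
      = mallows_E n q (\<lambda>p. of_bool (lehmer n i p < left_below i m p) * \<psi> p)"
    using le_iff_lehmer_less i m by (intro mallows_E_cong) simp
  then show ?thesis using gen[OF \<psi> m] full[OF dep] by simp
qed

section \<open>Concentration of the conditional distribution functions\<close>

lemma qnum_0 [simp]: "qnum q 0 = 0"
  unfolding qnum_def by simp

lemma qnum_Suc: "qnum q (Suc r) = qnum q r + q ^ r"
  unfolding qnum_def by simp

lemma qnum_Suc': "qnum q (Suc r) = 1 + q * qnum q r"
  unfolding qnum_def sum.lessThan_Suc_shift by (simp add: sum_distrib_left)

lemma qnum_geometric: "(1 - q) * qnum q r = 1 - q ^ r"
  by (induction r) (simp_all add: qnum_Suc distrib_left left_diff_distrib)

lemma qnum_nonneg: "q > 0 \<Longrightarrow> qnum q r \<ge> 0"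
  unfolding qnum_def by (intro sum_nonneg) auto

lemma qnum_mono: "q > 0 \<Longrightarrow> r \<le> s \<Longrightarrow> qnum q r \<le> qnum q s"
  unfolding qnum_def by (intro sum_mono2) auto

lemma qnum_ge_1: "q > 0 \<Longrightarrow> k \<ge> 1 \<Longrightarrow> qnum q k \<ge> 1"
  using qnum_mono[of q 1 k] by (simp add: qnum_Suc)

lemma qnum_pos: "q > 0 \<Longrightarrow> k \<ge> 1 \<Longrightarrow> qnum q k > 0"
  using qnum_ge_1[of q k] by simp

text \<open>The function \<open>\<Sum>j=1..r. q powi (-j)\<close>. It is the coordinate in which the number of unused values
up to \<open>m\<close> evolves linearly in the mean: using one more of them lowers it by \<open>1 / q ^ r\<close>, and this happens with probability
\<open>[r] / [k]\<close>, so the expected loss is a fixed multiple \<open>1 / [k]\<close> of the function itself.\<close>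

definition qweight :: "real \<Rightarrow> nat \<Rightarrow> real" where
  "qweight q r = qnum q r / q ^ r"

lemma qweight_0 [simp]: "qweight q 0 = 0"
  unfolding qweight_def by simp

lemma qweight_Suc: "q > 0 \<Longrightarrow> qweight q (Suc r) = qweight q r + 1 / q ^ Suc r"
  unfolding qweight_def qnum_Suc' by (simp add: field_simps)

lemma one_plus_qweight: "q > 0 \<Longrightarrow> 1 + (1 - q) * qweight q r = 1 / q ^ r"
  using qnum_geometric[of q r] unfolding qweight_def by (simp add: field_simps)

lemma qweight_left_below_Suc:
  assumes "q > 0" "p permutes {1..n}" "1 \<le> i" "i \<le> n" "m \<le> n"
  shows "qweight q (left_below (Suc i) m p)
    = qweight q (left_below i m p) - of_bool (p i \<le> m) * (1 / q ^ left_below i m p)"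
proof (cases "p i \<le> m")
  case True
  then have "left_below i m p \<noteq> 0" using le_iff_lehmer_less[of p n i m] assms by simp
  then obtain r where "left_below i m p = Suc r" by (cases "left_below i m p") auto
  then show ?thesis using True left_below_Suc[of p n i m] assms qweight_Suc[of q r] by simp
next
  case False
  then show ?thesis using left_below_Suc[of p n i m] assms by simp
qed

text \<open>The product of the factors \<open>1 - 1 / [k] = q * [k - 1] / [k]\<close> for \<open>k\<close> from \<open>n\<close> down to
\<open>n - i + 2\<close>, which telescopes, applied to the initial value \<open>qweight q m\<close>.\<close>

definition mean_qweight :: "nat \<Rightarrow> real \<Rightarrow> nat \<Rightarrow> nat \<Rightarrow> real" where
  "mean_qweight n q i m = qweight q m * q ^ (i - 1) * qnum q (Suc n - i) / qnum q n"

lemma mallows_E_qweight_Suc: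
  assumes q: "q > 0" and i: "1 \<le> i" "i \<le> n" and m: "m \<le> n"
  shows "mallows_E n q (\<lambda>p. qweight q (left_below (Suc i) m p))
    = mallows_E n q (\<lambda>p. qweight q (left_below i m p)) * (1 - 1 / qnum q (Suc n - i))"
proof -
  let ?k = "qnum q (Suc n - i)" and ?R = "left_below i m"
  have k: "?k > 0" using i by (intro qnum_pos q) simp
  have "mallows_E n q (\<lambda>p. qweight q (left_below (Suc i) m p))
    = mallows_E n q (\<lambda>p. qweight q (?R p) - of_bool (p i \<le> m) * (1 / q ^ ?R p))"
    using qweight_left_below_Suc q i m by (intro mallows_E_cong) blast
  also have "\<dots> = mallows_E n q (\<lambda>p. qweight q (?R p))
      - mallows_E n q (\<lambda>p. of_bool (p i \<le> m) * (1 / q ^ ?R p))"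
    by (rule mallows_E_diff)
  finally have diff: "mallows_E n q (\<lambda>p. qweight q (left_below (Suc i) m p))
      = mallows_E n q (\<lambda>p. qweight q (?R p))
        - mallows_E n q (\<lambda>p. of_bool (p i \<le> m) * (1 / q ^ ?R p))" .
  have "?k * mallows_E n q (\<lambda>p. of_bool (p i \<le> m) * (1 / q ^ ?R p))
      = mallows_E n q (\<lambda>p. qnum q (?R p) * (1 / q ^ ?R p))"
    by (rule mallows_E_le[OF q i m depends_before_left_below])
  then have "mallows_E n q (\<lambda>p. of_bool (p i \<le> m) * (1 / q ^ ?R p))
      = mallows_E n q (\<lambda>p. qweight q (?R p)) / ?k"
    using k unfolding qweight_def by (simp only: eq_divide_eq mult.commute[of ?k]) auto
  then show ?thesis unfolding diff by (simp add: right_diff_distrib)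
qed

lemma mallows_E_qweight:
  assumes q: "q > 0" and i: "1 \<le> i" "i \<le> n" and m: "m \<le> n"
  shows "mallows_E n q (\<lambda>p. qweight q (left_below i m p)) = mean_qweight n q i m"
  using i
proof (induction i rule: nat_induct_at_least)
  case base
  have "qnum q n > 0" using qnum_ge_1[OF q, of n] base by simp
  then show ?case using q unfolding mean_qweight_def by (simp add: mallows_E_const)
next
  case (Suc i)
  then have i: "1 \<le> i" "i \<le> n" by auto
  have k: "qnum q (Suc n - i) > 0" using i by (intro qnum_pos q) simp
  have "qnum q (Suc n - i) = 1 + q * qnum q (n - i)"
    using qnum_Suc'[of q "n - i"] i by (simp add: Suc_diff_le)
  then have "1 - 1 / qnum q (Suc n - i) = q * qnum q (n - i) / qnum q (Suc n - i)"
    using k by (simp add: field_simps)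
  moreover have "mallows_E n q (\<lambda>p. qweight q (left_below (Suc i) m p))
      = mean_qweight n q i m * (1 - 1 / qnum q (Suc n - i))"
    using mallows_E_qweight_Suc[OF q i m] Suc i by simp
  moreover have "q * q ^ (i - 1) = q ^ i" using i by (cases i) auto
  ultimately have "mallows_E n q (\<lambda>p. qweight q (left_below (Suc i) m p))
      = (qweight q m * q ^ (i - 1) * qnum q (Suc n - i) / qnum q n)
        * (q * qnum q (n - i) / qnum q (Suc n - i))" unfolding mean_qweight_def by simp
  also have "\<dots> = qweight q m * (q * q ^ (i - 1)) * qnum q (n - i) / qnum q n"
    using k by simp
  finally show ?case
    using \<open>q * q ^ (i - 1) = q ^ i\<close> unfolding mean_qweight_def by simp
qed

text \<open>The square of \<open>qweight\<close> loses \<open>2 * qweight q r / q ^ r - 1 / q ^ (2 * r)\<close> with probability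
\<open>[r] / [k]\<close>, so the second moment again satisfies a linear recursion, up to a drift term.\<close>

lemma mallows_E_square_Suc:
  assumes q: "q > 0" and i: "1 \<le> i" "i \<le> n" and m: "m \<le> n"
  shows "mallows_E n q (\<lambda>p. (qweight q (left_below (Suc i) m p))\<^sup>2)
    = mallows_E n q (\<lambda>p. (qweight q (left_below i m p))\<^sup>2) * (1 - 2 / qnum q (Suc n - i))
      + mallows_E n q (\<lambda>p. qweight q (left_below i m p) / q ^ left_below i m p)
          / qnum q (Suc n - i)"
proof -
  let ?k = "qnum q (Suc n - i)" and ?R = "left_below i m"
  let ?d = "\<lambda>p. 2 * qweight q (?R p) / q ^ ?R p - (1 / q ^ ?R p)\<^sup>2"
  have k: "?k > 0" using i by (intro qnum_pos q) simp
  have "mallows_E n q (\<lambda>p. (qweight q (left_below (Suc i) m p))\<^sup>2)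
    = mallows_E n q (\<lambda>p. (qweight q (?R p))\<^sup>2 - of_bool (p i \<le> m) * ?d p)"
  proof (rule mallows_E_cong)
    fix p assume "p permutes {1..n}"
    then show "(qweight q (left_below (Suc i) m p))\<^sup>2
        = (qweight q (?R p))\<^sup>2 - of_bool (p i \<le> m) * ?d p"
      using qweight_left_below_Suc[of q p n i m] q i m by (simp add: power2_diff)
  qed
  also have "\<dots> = mallows_E n q (\<lambda>p. (qweight q (?R p))\<^sup>2)
      - mallows_E n q (\<lambda>p. of_bool (p i \<le> m) * ?d p)"
    by (rule mallows_E_diff)
  finally have diff: "mallows_E n q (\<lambda>p. (qweight q (left_below (Suc i) m p))\<^sup>2)
      = mallows_E n q (\<lambda>p. (qweight q (?R p))\<^sup>2)
        - mallows_E n q (\<lambda>p. of_bool (p i \<le> m) * ?d p)" .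
  have "?k * mallows_E n q (\<lambda>p. of_bool (p i \<le> m) * ?d p)
      = mallows_E n q (\<lambda>p. qnum q (?R p) * ?d p)"
    by (rule mallows_E_le[OF q i m
        depends_before_left_below[of _ "\<lambda>r. 2 * qweight q r / q ^ r - (1 / q ^ r)\<^sup>2"]])
  moreover have "mallows_E n q (\<lambda>p. qnum q (?R p) * ?d p)
      = mallows_E n q (\<lambda>p. 2 * (qweight q (?R p))\<^sup>2 - qweight q (?R p) / q ^ ?R p)"
    using q by (intro mallows_E_cong) (simp add: qweight_def field_simps power2_eq_square)
  moreover have "mallows_E n q (\<lambda>p. 2 * (qweight q (?R p))\<^sup>2 - qweight q (?R p) / q ^ ?R p)
      = 2 * mallows_E n q (\<lambda>p. (qweight q (?R p))\<^sup>2)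
        - mallows_E n q (\<lambda>p. qweight q (?R p) / q ^ ?R p)"
    unfolding mallows_E_diff mallows_E_cmult ..
  ultimately have "?k * mallows_E n q (\<lambda>p. of_bool (p i \<le> m) * ?d p)
      = 2 * mallows_E n q (\<lambda>p. (qweight q (?R p))\<^sup>2)
        - mallows_E n q (\<lambda>p. qweight q (?R p) / q ^ ?R p)" by linarith
  then have "mallows_E n q (\<lambda>p. of_bool (p i \<le> m) * ?d p)
      = (2 * mallows_E n q (\<lambda>p. (qweight q (?R p))\<^sup>2)
        - mallows_E n q (\<lambda>p. qweight q (?R p) / q ^ ?R p)) / ?k"
    using k by (simp only: eq_divide_eq mult.commute[of ?k]) auto
  then show ?thesis unfolding diff by (simp add: right_diff_distrib diff_divide_distrib)
qed

lemma mallows_E_abs_le_sqrt: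
  assumes "q > 0"
  shows "mallows_E n q (\<lambda>p. \<bar>X p\<bar>) \<le> sqrt (mallows_E n q (\<lambda>p. (X p)\<^sup>2))"
proof -
  define a where "a = mallows_E n q (\<lambda>p. \<bar>X p\<bar>)"
  have "0 \<le> mallows_E n q (\<lambda>p. (\<bar>X p\<bar> - a)\<^sup>2)"
    using mallows_E_mono[of n "\<lambda>_. 0" "\<lambda>p. (\<bar>X p\<bar> - a)\<^sup>2" q] mallows_E_const[OF assms, of n 0] by simp
  also have "\<dots> = mallows_E n q (\<lambda>p. ((X p)\<^sup>2 + a\<^sup>2) - (2 * a) * \<bar>X p\<bar>)"
    by (intro mallows_E_cong) (simp add: power2_diff)
  also have "\<dots> = mallows_E n q (\<lambda>p. (X p)\<^sup>2) - a\<^sup>2"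
    unfolding mallows_E_diff mallows_E_add mallows_E_cmult mallows_E_const[OF assms] a_def[symmetric]
    by (simp add: power2_eq_square)
  finally show ?thesis unfolding a_def[symmetric] by (intro real_le_rsqrt) simp
qed

lemma variance_eq:
  assumes "q > 0"
  shows "mallows_E n q (\<lambda>p. (X p - mallows_E n q X)\<^sup>2)
    = mallows_E n q (\<lambda>p. (X p)\<^sup>2) - (mallows_E n q X)\<^sup>2"
proof -
  define a where "a = mallows_E n q X"
  have "mallows_E n q (\<lambda>p. (X p - a)\<^sup>2) = mallows_E n q (\<lambda>p. ((X p)\<^sup>2 + a\<^sup>2) - (2 * a) * X p)"
    by (intro mallows_E_cong) (simp add: power2_diff)
  also have "\<dots> = mallows_E n q (\<lambda>p. (X p)\<^sup>2) - a\<^sup>2"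
    unfolding mallows_E_diff mallows_E_add mallows_E_cmult mallows_E_const[OF assms] a_def[symmetric]
    by (simp add: power2_eq_square)
  finally show ?thesis unfolding a_def .
qed

text \<open>Let \<open>a = 1 / [k]\<close>. The two recursions combine to
\<open>V (i + 1) = V i * (1 - a)\<^sup>2 - a\<^sup>2 * S i + a * drift\<close>, where \<open>S\<close> is the second moment. The drift
is at most \<open>M\<^sup>2 * [k]\<close>, since \<open>R \<le> k\<close>; so each step adds at most \<open>M\<^sup>2\<close>.
A variance of order \<open>n\<close> means concentration, because \<open>qweight\<close> itself is of order \<open>n\<close>.\<close>

lemma variance_qweight_le:
  assumes q: "q > 0" and M: "\<And>k. k \<le> n \<Longrightarrow> 1 / q ^ k \<le> M" and i: "1 \<le> i" "i \<le> n" and m: "m \<le> n"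
  shows "mallows_E n q (\<lambda>p. (qweight q (left_below i m p) - mean_qweight n q i m)\<^sup>2) \<le> real (i - 1) * M\<^sup>2"
  using i
proof (induction i rule: nat_induct_at_least)
  case base
  have "qnum q n > 0" using qnum_ge_1[OF q, of n] base by simp
  then show ?case using mallows_E_const[OF q, of n 0] by (simp add: mean_qweight_def)
next
  case (Suc i)
  then have i: "1 \<le> i" "i \<le> n" by auto
  let ?R = "left_below i m" and ?a = "1 / qnum q (Suc n - i)"
  let ?V = "\<lambda>i. mallows_E n q (\<lambda>p. (qweight q (left_below i m p) - mean_qweight n q i m)\<^sup>2)"
  let ?S = "\<lambda>i. mallows_E n q (\<lambda>p. (qweight q (left_below i m p))\<^sup>2)"
  define E where "E = mean_qweight n q i m"
  have k1: "qnum q (Suc n - i) \<ge> 1" using i by (intro qnum_ge_1 q) simp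
  have a: "0 < ?a" "?a \<le> 1" using k1 by (simp_all add: field_simps)
  have M0: "M \<ge> 0" using M[of 0] by simp
  have V: "?V j = ?S j - (mean_qweight n q j m)\<^sup>2" if "1 \<le> j" "j \<le> n" for j
    using variance_eq[OF q, of n "\<lambda>p. qweight q (left_below j m p)"] mallows_E_qweight[OF q that m] by simp
  have E': "mean_qweight n q (Suc i) m = E * (1 - ?a)"
    using mallows_E_qweight_Suc[OF q i m] mallows_E_qweight[OF q i m]
      mallows_E_qweight[OF q _ _ m, of "Suc i"] Suc.prems unfolding E_def by simp
  have drift: "mallows_E n q (\<lambda>p. qweight q (?R p) / q ^ ?R p) \<le> M\<^sup>2 * qnum q (Suc n - i)"
  proof -
    have "mallows_E n q (\<lambda>p. qweight q (?R p) / q ^ ?R p) \<le> mallows_E n q (\<lambda>p. M\<^sup>2 * qnum q (Suc n - i))"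
    proof (rule mallows_E_mono)
      fix p assume "p permutes {1..n}"
      then have le: "?R p \<le> Suc n - i" using left_below_le[of p n i m] i m by simp
      then have "1 / q ^ ?R p \<le> M" using M[of "?R p"] i by simp
      moreover have "qnum q (?R p) \<le> qnum q (Suc n - i)" by (rule qnum_mono[OF q le])
      ultimately have "(1 / q ^ ?R p)\<^sup>2 * qnum q (?R p) \<le> M\<^sup>2 * qnum q (Suc n - i)"
        using q by (intro mult_mono power_mono) (auto simp: qnum_nonneg)
      then show "qweight q (?R p) / q ^ ?R p \<le> M\<^sup>2 * qnum q (Suc n - i)"
        unfolding qweight_def by (simp add: power2_eq_square)
    qed
    then show ?thesis by (simp add: mallows_E_const[OF q])
  qed
  have S0: "?S i \<ge> 0"
    using mallows_E_mono[of n "\<lambda>_. 0" _ q] mallows_E_const[OF q, of n 0] by simp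
  have V0: "?V i \<ge> 0"
    using mallows_E_mono[of n "\<lambda>_. 0" _ q] mallows_E_const[OF q, of n 0] by simp
  have "?V (Suc i) = ?S (Suc i) - (E * (1 - ?a))\<^sup>2"
    using V[of "Suc i"] Suc.prems E' by simp
  also have "?S (Suc i) = ?S i * (1 - 2 * ?a) + mallows_E n q (\<lambda>p. qweight q (?R p) / q ^ ?R p) * ?a"
    using mallows_E_square_Suc[OF q i m] by simp
  also have "mallows_E n q (\<lambda>p. qweight q (?R p) / q ^ ?R p) * ?a
      \<le> (M\<^sup>2 * qnum q (Suc n - i)) * ?a"
    using drift a by (intro mult_right_mono) auto
  also have "(M\<^sup>2 * qnum q (Suc n - i)) * ?a = M\<^sup>2" using k1 by simp
  finally have "?V (Suc i) \<le> ?S i * (1 - 2 * ?a) + M\<^sup>2 - (E * (1 - ?a))\<^sup>2" by simp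
  also have "\<dots> = ?V i * (1 - ?a)\<^sup>2 - ?a\<^sup>2 * ?S i + M\<^sup>2"
  proof -
    have "S * (1 - 2 * a) + N - (e * (1 - a))\<^sup>2 = (S - e\<^sup>2) * (1 - a)\<^sup>2 - a\<^sup>2 * S + N"
      for S a N e :: real by (simp add: algebra_simps power2_eq_square)
    then show ?thesis unfolding V[OF i] E_def .
  qed
  also have "\<dots> \<le> ?V i * 1 + M\<^sup>2"
  proof -
    have "(1 - ?a)\<^sup>2 \<le> 1" using a by (simp add: power_le_one)
    then have "?V i * (1 - ?a)\<^sup>2 \<le> ?V i * 1" using V0 by (intro mult_left_mono) auto
    moreover have "?a\<^sup>2 * ?S i \<ge> 0" using S0 by simp
    ultimately show ?thesis by linarith
  qed
  also have "\<dots> \<le> real (i - 1) * M\<^sup>2 + M\<^sup>2" using Suc i by simp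
  also have "\<dots> = real (Suc i - 1) * M\<^sup>2" using i by (simp add: of_nat_diff algebra_simps)
  finally show ?case .
qed

definition cond_cdf :: "nat \<Rightarrow> real \<Rightarrow> nat \<Rightarrow> nat \<Rightarrow> (nat \<Rightarrow> nat) \<Rightarrow> real" where
  "cond_cdf n q i m p = qnum q (left_below i m p) / qnum q (Suc n - i)"

text \<open>The conditional probability \<open>[R] / [k]\<close> with the random \<open>w = qweight q R\<close> replaced by its mean,
using \<open>[R] = w / (1 + (1 - q) * w)\<close>.\<close>

definition typical_cdf :: "nat \<Rightarrow> real \<Rightarrow> nat \<Rightarrow> nat \<Rightarrow> real" where
  "typical_cdf n q i m = mean_qweight n q i m / (1 + (1 - q) * mean_qweight n q i m)
     / qnum q (Suc n - i)"

text \<open>The map \<open>w \<mapsto> w / (1 + (1 - q) * w)\<close> has Lipschitz constant \<open>M\<^sup>2\<close> between the values of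
\<open>qweight\<close> and its mean, because both denominators are (means of) inverse powers of \<open>q\<close>. Division by
\<open>[k] \<ge> k / M\<close> costs another \<open>M / k\<close>, and the standard deviation of \<open>qweight\<close> is at most
\<open>M * sqrt n\<close>.\<close>

lemma mallows_E_cond_cdf_error:
  assumes q: "q > 0" and M: "\<And>k. k \<le> n \<Longrightarrow> 1 / q ^ k \<le> M" "\<And>k. k \<le> n \<Longrightarrow> q ^ k \<le> M"
    and i: "1 \<le> i" "i \<le> n" and m: "m \<le> n"
  shows "mallows_E n q (\<lambda>p. \<bar>cond_cdf n q i m p - typical_cdf n q i m\<bar>)
    \<le> M ^ 4 * sqrt n / real (Suc n - i)"
proof -
  define e where "e = mean_qweight n q i m"
  define k where "k = Suc n - i"
  have k: "k \<ge> 1" "k \<le> n" using i unfolding k_def by auto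
  have M1: "M \<ge> 1" using M(1)[of 0] by simp
  have qk: "real k / M \<le> qnum q k"
  proof -
    have "(\<Sum>j<k. 1 / M) \<le> qnum q k" unfolding qnum_def
    proof (rule sum_mono)
      fix j assume "j \<in> {..<k}"
      then have "1 / q ^ j \<le> M" using M(1) k by simp
      then show "1 / M \<le> q ^ j" using q M1 by (simp add: field_simps)
    qed
    then show ?thesis by simp
  qed
  have inv_pow: "1 / M \<le> 1 / q ^ left_below i m p" if "p permutes {1..n}" for p
  proof -
    have "left_below i m p \<le> n" using left_below_le[OF that, of i m] i m by simp
    then have "q ^ left_below i m p \<le> M" using M(2) by simp
    then show ?thesis using q M1 by (intro divide_left_mono) auto
  qed
  have den: "1 / M \<le> 1 + (1 - q) * e"
  proof -
    have "1 / M = mallows_E n q (\<lambda>p. 1 / M)" using mallows_E_const[OF q] by simp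
    also have "\<dots> \<le> mallows_E n q (\<lambda>p. 1 / q ^ left_below i m p)"
      by (rule mallows_E_mono) (rule inv_pow)
    also have "\<dots> = mallows_E n q (\<lambda>p. 1 + (1 - q) * qweight q (left_below i m p))"
      using one_plus_qweight[OF q] by simp
    also have "\<dots> = 1 + (1 - q) * e"
      unfolding mallows_E_add mallows_E_cmult mallows_E_const[OF q] mallows_E_qweight[OF q i m] e_def ..
    finally show ?thesis .
  qed
  have "mallows_E n q (\<lambda>p. \<bar>cond_cdf n q i m p - typical_cdf n q i m\<bar>)
    \<le> mallows_E n q (\<lambda>p. (M ^ 3 / real k) * \<bar>qweight q (left_below i m p) - e\<bar>)"
  proof (rule mallows_E_mono)
    fix p assume p: "p permutes {1..n}"
    define w where "w = qweight q (left_below i m p)"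
    define D where "D = 1 + (1 - q) * w"
    define D' where "D' = 1 + (1 - q) * e"
    have D: "D = 1 / q ^ left_below i m p" unfolding D_def w_def by (rule one_plus_qweight[OF q])
    have DM: "1 / M \<le> D" "1 / M \<le> D'" using inv_pow[OF p] den D D'_def by simp_all
    then have pos: "D > 0" "D' > 0" using M1 by (auto intro: less_le_trans[of 0 "1 / M"])
    have invs: "1 / D \<le> M" "1 / D' \<le> M" using DM pos M1 by (simp_all add: field_simps)
    then have inv: "1 / D * (1 / D') \<le> M * M" using pos M1 by (intro mult_mono) auto
    have "qnum q (left_below i m p) = w / D" unfolding D w_def qweight_def using q by simp
    then have "cond_cdf n q i m p - typical_cdf n q i m = (w / D - e / D') / qnum q k"
      unfolding cond_cdf_def typical_cdf_def D'_def e_def k_def by (simp add: diff_divide_distrib)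
    also have "w / D - e / D' = (w - e) * (1 / D * (1 / D'))"
      using pos unfolding D_def D'_def by (simp add: field_simps)
    finally have "\<bar>cond_cdf n q i m p - typical_cdf n q i m\<bar>
        = \<bar>w - e\<bar> * (1 / D * (1 / D')) * (1 / qnum q k)"
      using pos qnum_nonneg[OF q, of k] by (simp add: abs_mult)
    also have "\<dots> \<le> \<bar>w - e\<bar> * (M * M) * (M / real k)"
    proof (intro mult_mono)
      have "qnum q k > 0" using k by (intro qnum_pos q)
      then show "1 / qnum q k \<le> M / real k"
        using qk k M1 by (simp add: field_simps)
    qed (use invs M1 qnum_nonneg[OF q] pos in auto)
    finally show "\<bar>cond_cdf n q i m p - typical_cdf n q i m\<bar>
        \<le> (M ^ 3 / real k) * \<bar>qweight q (left_below i m p) - e\<bar>"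
      unfolding w_def by (simp add: power3_eq_cube mult_ac)
  qed
  also have "\<dots> = (M ^ 3 / real k) * mallows_E n q (\<lambda>p. \<bar>qweight q (left_below i m p) - e\<bar>)"
    by (rule mallows_E_cmult)
  also have "\<dots> \<le> (M ^ 3 / real k) * (sqrt n * M)"
  proof (rule mult_left_mono)
    have "mallows_E n q (\<lambda>p. \<bar>qweight q (left_below i m p) - e\<bar>)
      \<le> sqrt (mallows_E n q (\<lambda>p. (qweight q (left_below i m p) - e)\<^sup>2))"
      by (rule mallows_E_abs_le_sqrt[OF q])
    also have "\<dots> \<le> sqrt (real n * M\<^sup>2)"
    proof (rule real_sqrt_le_mono)
      have "mallows_E n q (\<lambda>p. (qweight q (left_below i m p) - e)\<^sup>2) \<le> real (i - 1) * M\<^sup>2"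
        unfolding e_def by (rule variance_qweight_le[OF q M(1) i m])
      also have "\<dots> \<le> real n * M\<^sup>2" using i by (intro mult_right_mono) auto
      finally show "mallows_E n q (\<lambda>p. (qweight q (left_below i m p) - e)\<^sup>2) \<le> real n * M\<^sup>2" .
    qed
    also have "\<dots> = sqrt n * M" using M1 by (simp add: real_sqrt_mult)
    finally show "mallows_E n q (\<lambda>p. \<bar>qweight q (left_below i m p) - e\<bar>) \<le> sqrt n * M" .
  qed (use M1 in auto)
  also have "\<dots> = M ^ 4 * sqrt n / real (Suc n - i)"
    unfolding k_def by (simp add: power_numeral_reduce)
  finally show ?thesis .
qed

section \<open>A quantitative law of large numbers\<close>

lemma abel_summation_lessThan:
  fixes g d :: "nat \<Rightarrow> real"
  assumes "d 0 = 0"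
  shows "(\<Sum>m<n. g (Suc m) * (d (Suc m) - d m)) = g n * d n - (\<Sum>m<n. (g (Suc m) - g m) * d m)"
  using assms by (induction n) (simp_all add: algebra_simps)

lemma typical_cdf_0: "typical_cdf n q i 0 = 0"
  unfolding typical_cdf_def mean_qweight_def by simp

lemma typical_cdf_full:
  assumes q: "q > 0" and i: "1 \<le> i" "i \<le> n"
  shows "typical_cdf n q i n = 1"
proof -
  have k: "qnum q (Suc n - i) > 0" "qnum q n > 0" using i by (auto intro: qnum_pos q)
  have "q ^ n = q ^ (i - 1) * q ^ (Suc n - i)" using i by (simp flip: power_add)
  then have "mean_qweight n q i n = qweight q (Suc n - i)"
    using k q unfolding mean_qweight_def qweight_def by (simp add: field_simps)
  then show ?thesis
    using k q one_plus_qweight[OF q, of "Suc n - i"] unfolding typical_cdf_def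
    by (simp add: qweight_def)
qed

lemma cond_cdf_0: "cond_cdf n q i 0 p = 0"
  unfolding cond_cdf_def by simp

lemma cond_cdf_full:
  assumes "q > 0" "p permutes {1..n}" "1 \<le> i" "i \<le> n"
  shows "cond_cdf n q i n p = 1"
proof -
  have "qnum q (Suc n - i) > 0" using assms by (intro qnum_pos) auto
  then show ?thesis unfolding cond_cdf_def using left_below_full[of p n i] assms by simp
qed

lemma depends_before_sum:
  "(\<And>a. a \<in> A \<Longrightarrow> depends_before i (X a)) \<Longrightarrow> depends_before i (\<lambda>p. \<Sum>a\<in>A. X a p)"
  unfolding depends_before_def by (auto intro!: sum.cong)

lemma depends_before_diff:
  "depends_before i \<psi> \<Longrightarrow> depends_before i \<theta> \<Longrightarrow> depends_before i (\<lambda>p. \<psi> p - \<theta> p)"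
  unfolding depends_before_def by metis

lemma depends_before_le: "depends_before i \<psi> \<Longrightarrow> i \<le> k \<Longrightarrow> depends_before k \<psi>"
  unfolding depends_before_def by (meson less_le_trans)

lemma depends_before_apply: "i < k \<Longrightarrow> depends_before k (\<lambda>p. g (p i))"
  unfolding depends_before_def by auto

definition cond_mean :: "nat \<Rightarrow> real \<Rightarrow> nat \<Rightarrow> (nat \<Rightarrow> real) \<Rightarrow> (nat \<Rightarrow> nat) \<Rightarrow> real" where
  "cond_mean n q i g p = (\<Sum>m<n. g (Suc m) * (cond_cdf n q i (Suc m) p - cond_cdf n q i m p))"

text \<open>The integral of \<open>g\<close> against the deterministic distribution function \<open>typical_cdf\<close>, as
\<open>cond_mean\<close> is its integral against the conditional one.\<close>

definition typical_mean :: "nat \<Rightarrow> real \<Rightarrow> nat \<Rightarrow> (nat \<Rightarrow> real) \<Rightarrow> real" where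
  "typical_mean n q i g = (\<Sum>m<n. g (Suc m) * (typical_cdf n q i (Suc m) - typical_cdf n q i m))"

lemma depends_before_cond_mean: "depends_before i (cond_mean n q i g)"
proof -
  have c: "depends_before i (cond_cdf n q i m)" for m
    unfolding cond_cdf_def
    by (rule depends_before_left_below[of i "\<lambda>r. qnum q r / qnum q (Suc n - i)"])
  have *: "depends_before i (\<lambda>p. g (Suc m))" for m
    unfolding depends_before_def by simp
  show ?thesis unfolding cond_mean_def
    by (intro depends_before_sum depends_before_mult depends_before_diff c *)
qed

lemma mallows_E_cond_mean:
  assumes q: "q > 0" and i: "1 \<le> i" "i \<le> n" and \<psi>: "depends_before i \<psi>"
  shows "mallows_E n q (\<lambda>p. g (p i) * \<psi> p) = mallows_E n q (\<lambda>p. cond_mean n q i g p * \<psi> p)"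
proof -
  have cdf: "mallows_E n q (\<lambda>p. of_bool (p i \<le> m) * \<psi> p) = mallows_E n q (\<lambda>p. cond_cdf n q i m p * \<psi> p)"
    if "m \<le> n" for m
  proof -
    have k: "qnum q (Suc n - i) > 0" using i by (intro qnum_pos q) auto
    have "mallows_E n q (\<lambda>p. cond_cdf n q i m p * \<psi> p)
      = mallows_E n q (\<lambda>p. (1 / qnum q (Suc n - i)) * (qnum q (left_below i m p) * \<psi> p))"
      unfolding cond_cdf_def by simp
    also have "\<dots> = (1 / qnum q (Suc n - i)) * mallows_E n q (\<lambda>p. qnum q (left_below i m p) * \<psi> p)"
      by (rule mallows_E_cmult)
    finally have "mallows_E n q (\<lambda>p. cond_cdf n q i m p * \<psi> p)
        = mallows_E n q (\<lambda>p. qnum q (left_below i m p) * \<psi> p) / qnum q (Suc n - i)" by simp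
    then show ?thesis unfolding mallows_E_le[OF q i that \<psi>, symmetric] using k by simp
  qed
  have "mallows_E n q (\<lambda>p. g (p i) * \<psi> p)
    = mallows_E n q (\<lambda>p. \<Sum>m<n. g (Suc m) * (of_bool (p i \<le> Suc m) * \<psi> p - of_bool (p i \<le> m) * \<psi> p))"
  proof (rule mallows_E_cong)
    fix p assume p: "p permutes {1..n}"
    have "p i \<in> {1..n}" using permutes_in_image[OF p, of i] i by simp
    then obtain v where v: "p i = Suc v" "v < n" by (cases "p i") auto
    have "(\<Sum>m<n. g (Suc m) * (of_bool (p i \<le> Suc m) * \<psi> p - of_bool (p i \<le> m) * \<psi> p))
        = (\<Sum>m<n. if m = v then g (Suc v) * \<psi> p else 0)"
      using v by (intro sum.cong) auto
    also have "\<dots> = g (p i) * \<psi> p" using v by simp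
    finally show "g (p i) * \<psi> p
        = (\<Sum>m<n. g (Suc m) * (of_bool (p i \<le> Suc m) * \<psi> p - of_bool (p i \<le> m) * \<psi> p))" ..
  qed
  also have "\<dots> = (\<Sum>m<n. g (Suc m) * (mallows_E n q (\<lambda>p. cond_cdf n q i (Suc m) p * \<psi> p)
      - mallows_E n q (\<lambda>p. cond_cdf n q i m p * \<psi> p)))"
    unfolding mallows_E_sum mallows_E_cmult mallows_E_diff using cdf by (intro sum.cong) auto
  also have "\<dots> = mallows_E n q (\<lambda>p. \<Sum>m<n. g (Suc m) *
      (cond_cdf n q i (Suc m) p * \<psi> p - cond_cdf n q i m p * \<psi> p))"
    unfolding mallows_E_sum mallows_E_cmult mallows_E_diff ..
  also have "\<dots> = mallows_E n q (\<lambda>p. cond_mean n q i g p * \<psi> p)"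
    by (simp only: cond_mean_def sum_distrib_right mult.assoc left_diff_distrib)
  finally show ?thesis .
qed

text \<open>The summands are martingale differences, so the cross terms vanish, and the conditional variance
of each bounded summand is at most \<open>B\<^sup>2\<close>.\<close>

lemma mallows_E_martingale_square:
  assumes q: "q > 0" and B: "\<And>i m. i \<in> {1..n} \<Longrightarrow> m \<in> {1..n} \<Longrightarrow> \<bar>g i m\<bar> \<le> B" and k: "k \<le> n"
  shows "mallows_E n q (\<lambda>p. (\<Sum>i=1..k. g i (p i) - cond_mean n q i (g i) p)\<^sup>2) \<le> real k * B\<^sup>2"
  using k
proof (induction k)
  case 0
  then show ?case using mallows_E_const[OF q, of n 0] by simp
next
  case (Suc k)
  let ?i = "Suc k"
  have i: "1 \<le> ?i" "?i \<le> n" using Suc.prems by auto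
  let ?X = "\<lambda>p. g ?i (p ?i)" and ?A = "cond_mean n q ?i (g ?i)"
  let ?S = "\<lambda>p. \<Sum>i=1..k. g i (p i) - cond_mean n q i (g i) p"
  have dA: "depends_before ?i ?A" by (rule depends_before_cond_mean)
  have dS: "depends_before ?i ?S"
    by (intro depends_before_sum depends_before_diff depends_before_apply
        depends_before_le[OF depends_before_cond_mean]) auto
  have "mallows_E n q (\<lambda>p. (\<Sum>i=1..?i. g i (p i) - cond_mean n q i (g i) p)\<^sup>2)
    = mallows_E n q (\<lambda>p. ((?S p)\<^sup>2 + (?X p)\<^sup>2 + 2 * (?X p * ?S p - ?A p * ?S p))
        - (2 * (?X p * ?A p - ?A p * ?A p) + (?A p)\<^sup>2))"
    by (intro mallows_E_cong) (simp add: power2_eq_square algebra_simps)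
  also have "\<dots> = mallows_E n q (\<lambda>p. (?S p)\<^sup>2) + mallows_E n q (\<lambda>p. (?X p)\<^sup>2)
      - mallows_E n q (\<lambda>p. (?A p)\<^sup>2)"
    unfolding mallows_E_diff mallows_E_add mallows_E_cmult
    using mallows_E_cond_mean[OF q i dA, of "g ?i"] mallows_E_cond_mean[OF q i dS, of "g ?i"] by simp
  also have "\<dots> \<le> real k * B\<^sup>2 + B\<^sup>2 - 0"
  proof (intro diff_mono add_mono)
    show "mallows_E n q (\<lambda>p. (?S p)\<^sup>2) \<le> real k * B\<^sup>2" using Suc by simp
    have "mallows_E n q (\<lambda>p. (?X p)\<^sup>2) \<le> mallows_E n q (\<lambda>p. B\<^sup>2)"
    proof (rule mallows_E_mono)
      fix p assume p: "p permutes {1..n}"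
      have "p ?i \<in> {1..n}" using permutes_in_image[OF p, of ?i] i by simp
      then have "\<bar>g ?i (p ?i)\<bar> \<le> B" using i by (intro B) auto
      then show "(g ?i (p ?i))\<^sup>2 \<le> B\<^sup>2" by (metis abs_ge_zero power2_abs power_mono)
    qed
    then show "mallows_E n q (\<lambda>p. (?X p)\<^sup>2) \<le> B\<^sup>2" by (simp add: mallows_E_const[OF q])
    show "0 \<le> mallows_E n q (\<lambda>p. (?A p)\<^sup>2)"
      using mallows_E_mono[of n "\<lambda>_. 0" "\<lambda>p. (?A p)\<^sup>2" q] mallows_E_const[OF q, of n 0] by simp
  qed
  also have "\<dots> = real ?i * B\<^sup>2" by (simp add: algebra_simps)
  finally show ?case .
qed

text \<open>Summation by parts moves the difference from the increments of the distribution functions to the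
increments of \<open>g\<close>; the boundary terms vanish since both distribution functions run from 0 to 1.\<close>

lemma mallows_E_cond_mean_error:
  assumes q: "q > 0" and M: "\<And>k. k \<le> n \<Longrightarrow> 1 / q ^ k \<le> M" "\<And>k. k \<le> n \<Longrightarrow> q ^ k \<le> M"
    and i: "1 \<le> i" "i \<le> n" and L: "\<And>m. 1 \<le> m \<Longrightarrow> m < n \<Longrightarrow> \<bar>g (Suc m) - g m\<bar> \<le> L"
    and L0: "L \<ge> 0"
  shows "mallows_E n q (\<lambda>p. \<bar>cond_mean n q i g p - typical_mean n q i g\<bar>)
    \<le> real n * L * (M ^ 4 * sqrt n / real (Suc n - i))"
proof -
  let ?d = "\<lambda>m p. cond_cdf n q i m p - typical_cdf n q i m"
  have "mallows_E n q (\<lambda>p. \<bar>cond_mean n q i g p - typical_mean n q i g\<bar>)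
    \<le> mallows_E n q (\<lambda>p. \<Sum>m<n. L * \<bar>?d m p\<bar>)"
  proof (rule mallows_E_mono)
    fix p assume p: "p permutes {1..n}"
    have d: "?d 0 p = 0" "?d n p = 0"
      using cond_cdf_0 typical_cdf_0 cond_cdf_full[OF q p i] typical_cdf_full[OF q i] by simp_all
    have "cond_mean n q i g p - typical_mean n q i g = (\<Sum>m<n. g (Suc m) * (?d (Suc m) p - ?d m p))"
      unfolding cond_mean_def typical_mean_def by (simp add: sum_subtractf right_diff_distrib)
    also have "\<dots> = - (\<Sum>m<n. (g (Suc m) - g m) * ?d m p)"
      using abel_summation_lessThan[of "\<lambda>m. ?d m p" g n] d by simp
    also have "\<bar>\<dots>\<bar> \<le> (\<Sum>m<n. \<bar>(g (Suc m) - g m) * ?d m p\<bar>)" by simp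
    also have "\<dots> \<le> (\<Sum>m<n. L * \<bar>?d m p\<bar>)"
    proof (rule sum_mono)
      fix m assume "m \<in> {..<n}"
      then show "\<bar>(g (Suc m) - g m) * ?d m p\<bar> \<le> L * \<bar>?d m p\<bar>"
        using L[of m] d by (cases "m = 0") (auto simp: abs_mult intro!: mult_right_mono)
    qed
    finally show "\<bar>cond_mean n q i g p - typical_mean n q i g\<bar> \<le> (\<Sum>m<n. L * \<bar>?d m p\<bar>)" .
  qed
  also have "\<dots> = (\<Sum>m<n. L * mallows_E n q (\<lambda>p. \<bar>?d m p\<bar>))"
    unfolding mallows_E_sum mallows_E_cmult ..
  also have "\<dots> \<le> (\<Sum>m<n. L * (M ^ 4 * sqrt n / real (Suc n - i)))"
    using mallows_E_cond_cdf_error[OF q M i] L0 by (intro sum_mono mult_left_mono) auto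
  finally show ?thesis by simp
qed

text \<open>The deviation splits into a martingale, of size \<open>B / sqrt n\<close>, and the error of replacing conditional
means by deterministic ones. The latter is of order \<open>sqrt n / k\<close> with \<open>k\<close> values left, and
averaging it over the positions gives the harmonic number.\<close>

lemma mallows_LLN:
  assumes q: "q > 0" and M: "\<And>k. k \<le> n \<Longrightarrow> 1 / q ^ k \<le> M" "\<And>k. k \<le> n \<Longrightarrow> q ^ k \<le> M"
    and B: "\<And>i m. i \<in> {1..n} \<Longrightarrow> m \<in> {1..n} \<Longrightarrow> \<bar>g i m\<bar> \<le> B"
    and L: "\<And>i m. i \<in> {1..n} \<Longrightarrow> 1 \<le> m \<Longrightarrow> m < n \<Longrightarrow> \<bar>g i (Suc m) - g i m\<bar> \<le> L / n"
    and L0: "L \<ge> 0" and n: "n \<ge> 1"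
  shows "mallows_E n q (\<lambda>p. \<bar>1 / n * (\<Sum>i=1..n. g i (p i)) - 1 / n * (\<Sum>i=1..n. typical_mean n q i (g i))\<bar>)
    \<le> B / sqrt n + L * M ^ 4 * (harm n / sqrt n)"
proof -
  let ?Y = "\<lambda>p. \<Sum>i=1..n. g i (p i) - cond_mean n q i (g i) p"
  let ?Z = "\<lambda>i p. cond_mean n q i (g i) p - typical_mean n q i (g i)"
  have B0: "B \<ge> 0" using B[of 1 1] n by fastforce
  have "mallows_E n q (\<lambda>p. \<bar>1 / n * (\<Sum>i=1..n. g i (p i)) - 1 / n * (\<Sum>i=1..n. typical_mean n q i (g i))\<bar>)
    \<le> mallows_E n q (\<lambda>p. (1 / n) * (\<bar>?Y p\<bar> + (\<Sum>i=1..n. \<bar>?Z i p\<bar>)))"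
  proof (rule mallows_E_mono)
    fix p
    have "(\<Sum>i=1..n. g i (p i)) - (\<Sum>i=1..n. typical_mean n q i (g i)) = ?Y p + (\<Sum>i=1..n. ?Z i p)"
      by (simp add: sum_subtractf)
    then have "\<bar>(\<Sum>i=1..n. g i (p i)) - (\<Sum>i=1..n. typical_mean n q i (g i))\<bar>
        \<le> \<bar>?Y p\<bar> + (\<Sum>i=1..n. \<bar>?Z i p\<bar>)"
      using sum_abs[of "\<lambda>i. ?Z i p" "{1..n}"] by linarith
    then show "\<bar>1 / n * (\<Sum>i=1..n. g i (p i)) - 1 / n * (\<Sum>i=1..n. typical_mean n q i (g i))\<bar>
        \<le> (1 / n) * (\<bar>?Y p\<bar> + (\<Sum>i=1..n. \<bar>?Z i p\<bar>))"
      using n by (simp add: abs_mult field_simps flip: right_diff_distrib diff_divide_distrib)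
  qed
  also have "\<dots> = (1 / n) * (mallows_E n q (\<lambda>p. \<bar>?Y p\<bar>) + (\<Sum>i=1..n. mallows_E n q (\<lambda>p. \<bar>?Z i p\<bar>)))"
    unfolding mallows_E_sum mallows_E_cmult mallows_E_add ..
  also have "\<dots> \<le> (1 / n) * (sqrt n * B + (\<Sum>i=1..n. L * M ^ 4 * sqrt n * inverse (real (Suc n - i))))"
  proof (intro mult_left_mono add_mono sum_mono)
    have "mallows_E n q (\<lambda>p. \<bar>?Y p\<bar>) \<le> sqrt (mallows_E n q (\<lambda>p. (?Y p)\<^sup>2))"
      by (rule mallows_E_abs_le_sqrt[OF q])
    also have "\<dots> \<le> sqrt (real n * B\<^sup>2)"
      by (intro real_sqrt_le_mono mallows_E_martingale_square q B) auto
    also have "\<dots> = sqrt n * B" using B0 by (simp add: real_sqrt_mult)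
    finally show "mallows_E n q (\<lambda>p. \<bar>?Y p\<bar>) \<le> sqrt n * B" .
  next
    fix i assume i: "i \<in> {1..n}"
    have "mallows_E n q (\<lambda>p. \<bar>?Z i p\<bar>) \<le> real n * (L / n) * (M ^ 4 * sqrt n / real (Suc n - i))"
      using i L L0 by (intro mallows_E_cond_mean_error q M) auto
    then show "mallows_E n q (\<lambda>p. \<bar>?Z i p\<bar>) \<le> L * M ^ 4 * sqrt n * inverse (real (Suc n - i))"
      using n by (simp add: field_simps)
  qed simp
  also have "(\<Sum>i=1..n. L * M ^ 4 * sqrt n * inverse (real (Suc n - i))) = L * M ^ 4 * sqrt n * harm n"
  proof -
    have "(\<Sum>i=1..n. inverse (real (Suc n - i))) = harm n"
      unfolding harm_def
      by (rule sum.reindex_bij_witness[of _ "\<lambda>i. Suc n - i" "\<lambda>i. Suc n - i"]) auto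
    then show ?thesis by (simp add: sum_distrib_left[symmetric])
  qed
  also have "(1 / n) * (sqrt n * B + L * M ^ 4 * sqrt n * harm n) = B / sqrt n + L * M ^ 4 * (harm n / sqrt n)"
  proof -
    have "sqrt n / n = 1 / sqrt n" using n by (simp add: field_simps)
    moreover have "(1 / n) * (sqrt n * B + L * M ^ 4 * sqrt n * harm n)
        = (sqrt n / n) * (B + L * M ^ 4 * harm n)"
      by (simp add: algebra_simps add_divide_distrib)
    ultimately show ?thesis by (simp add: add_divide_distrib)
  qed
  finally show ?thesis .
qed

lemma harm_over_sqrt_tendsto_0: "(\<lambda>n. harm n / sqrt (real n)) \<longlonglongrightarrow> 0"
proof -
  have s: "filterlim (\<lambda>n. sqrt (real n)) at_top sequentially"
    by (intro filterlim_compose[OF sqrt_at_top filterlim_real_sequentially])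
  have "(\<lambda>n. (harm n - ln (real n)) / sqrt (real n)) \<longlonglongrightarrow> 0"
    by (rule tendsto_divide_0[OF euler_mascheroni_LIMSEQ filterlim_at_top_imp_at_infinity[OF s]])
  moreover have "((\<lambda>x::real. ln x / sqrt x) \<longlongrightarrow> 0) at_top" by real_asymp
  then have "(\<lambda>n. ln (real n) / sqrt (real n)) \<longlonglongrightarrow> 0"
    by (rule filterlim_compose[OF _ filterlim_real_sequentially])
  ultimately have "(\<lambda>n. (harm n - ln (real n)) / sqrt (real n) + ln (real n) / sqrt (real n)) \<longlonglongrightarrow> 0 + 0"
    by (rule tendsto_add)
  then show ?thesis by (simp flip: add_divide_distrib)
qed

section \<open>The limiting density\<close>

text \<open>The entire function \<open>(exp z - 1) / z\<close>. Writing the density through it removes the singularity at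
\<open>b = 0\<close>, so that convergence of the parameter can be used without distinguishing whether it tends to 0.\<close>

definition exp_quot :: "real \<Rightarrow> real" where
  "exp_quot z = (if z = 0 then 1 else (exp z - 1) / z)"

lemma times_exp_quot: "z * exp_quot z = exp z - 1"
  unfolding exp_quot_def by simp

lemma exp_quot_0 [simp]: "exp_quot 0 = 1"
  unfolding exp_quot_def by simp

lemma exp_quot_pos: "exp_quot z > 0"
  unfolding exp_quot_def
  by (cases z "0 :: real" rule: linorder_cases) (simp_all add: zero_less_divide_iff)

lemma isCont_exp_quot: "isCont exp_quot z"
proof (cases "z = 0")
  case True
  have "((\<lambda>z::real. (exp z - 1) / z) \<longlongrightarrow> 1) (at 0)" by (rule lim_exp_minus_1)
  then have "(exp_quot \<longlongrightarrow> 1) (at 0)"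
    by (rule tendsto_cong[THEN iffD1, rotated]) (auto simp: exp_quot_def eventually_at_filter)
  then show ?thesis using True by (simp add: isCont_def)
next
  case False
  have "\<forall>\<^sub>F w in nhds z. w \<noteq> 0" using False by (rule t1_space_nhds)
  then have "\<forall>\<^sub>F w in nhds z. exp_quot w = (exp w - 1) / w"
    by eventually_elim (simp add: exp_quot_def)
  then show ?thesis using False by (subst isCont_cong) (auto intro!: continuous_intros)
qed

lemma continuous_on_exp_quot [continuous_intros]:
  "continuous_on S f \<Longrightarrow> continuous_on S (\<lambda>x. exp_quot (f x))"
  by (rule continuous_on_compose2[of UNIV exp_quot])
    (auto intro: continuous_at_imp_continuous_on isCont_exp_quot)

text \<open>For \<open>b \<noteq> 0\<close>, up to an exponential factor and the factor \<open>b / 2\<close>, this is the difference of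
hyperbolic cosines in the denominator of \<open>mallows_u\<close>. In this form continuity in all variables, also at \<open>b = 0\<close>, and
positivity for \<open>x\<close> in the unit interval can be read off.\<close>

definition mallows_denom :: "real \<Rightarrow> real \<Rightarrow> real \<Rightarrow> real" where
  "mallows_denom b x y =
     x * exp_quot (- b * x) + (1 - x) * exp_quot (b * (1 - x)) * exp (b * (y - 1))"

text \<open>The limit of \<open>typical_cdf\<close>: the distribution function in \<open>y\<close> of the value at relative
position \<open>x\<close>.\<close>

definition mallows_cdf :: "real \<Rightarrow> real \<Rightarrow> real \<Rightarrow> real" where
  "mallows_cdf b x y = y * exp_quot (b * y) * exp (- b * x) / mallows_denom b x y"

lemma mallows_denom_pos: "x \<in> {0..1} \<Longrightarrow> mallows_denom b x y > 0"
proof -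
  assume x: "x \<in> {0..1}"
  have "x * exp_quot (- b * x) \<ge> 0" "(1 - x) * exp_quot (b * (1 - x)) * exp (b * (y - 1)) \<ge> 0"
    using x exp_quot_pos[of "- b * x"] exp_quot_pos[of "b * (1 - x)"] by simp_all
  moreover have "x * exp_quot (- b * x) > 0 \<or> (1 - x) * exp_quot (b * (1 - x)) * exp (b * (y - 1)) > 0"
    using x exp_quot_pos[of "- b * x"] exp_quot_pos[of "b * (1 - x)"] by (cases "x = 0") simp_all
  ultimately show ?thesis unfolding mallows_denom_def by linarith
qed

lemma times_mallows_denom:
  "b * mallows_denom b x y = 1 - exp (- b * x) + exp (b * y) * (exp (- b * x) - exp (- b))"
proof -
  have "b * mallows_denom b x y = - ((- b * x) * exp_quot (- b * x))
      + ((b * (1 - x)) * exp_quot (b * (1 - x))) * exp (b * (y - 1))"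
    unfolding mallows_denom_def by (simp add: algebra_simps)
  also have "\<dots> = - (exp (- b * x) - 1) + (exp (b * (1 - x)) - 1) * exp (b * (y - 1))"
    unfolding times_exp_quot ..
  also have "exp (b * (1 - x)) = exp b * exp (- b * x)"
    by (simp add: algebra_simps exp_add[symmetric])
  also have "exp (b * (y - 1)) = exp (b * y) * exp (- b)"
    by (simp add: algebra_simps exp_add[symmetric])
  also have "- (exp (- b * x) - 1) + (exp b * exp (- b * x) - 1) * (exp (b * y) * exp (- b))
      = 1 - exp (- b * x) + exp (b * y) * (exp (- b * x) * (exp b * exp (- b)) - exp (- b))"
    by (simp add: algebra_simps)
  also have "exp b * exp (- b) = 1" by (simp flip: exp_add)
  finally show ?thesis by simp
qed

lemma mallows_u_eq:
  "mallows_u x y b = exp_quot (- b) * exp (b * (y - x)) / (mallows_denom b x y)\<^sup>2"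
proof (cases "b = 0")
  case True
  then show ?thesis unfolding mallows_u_def mallows_denom_def by simp
next
  case False
  define s where "s = exp (b / 4 + b * (x - y) / 2)"
  have s: "s > 0" "s\<^sup>2 = exp (b / 2) * exp (b * (x - y))"
    unfolding s_def by (simp_all add: power2_eq_square exp_add[symmetric] field_simps)
  have sinh: "sinh (b / 2) = exp (b / 2) * (b * exp_quot (- b)) / 2"
  proof -
    have "b * exp_quot (- b) = 1 - exp (- b)" using times_exp_quot[of "- b"] by simp
    moreover have "exp (b / 2) * exp (- b) = exp (- (b / 2))" by (simp flip: exp_add)
    ultimately show ?thesis by (simp add: sinh_def right_diff_distrib)
  qed
  have denom: "exp (b / 4) * cosh (b * (x - y) / 2) - exp (- b / 4) * cosh (b * (x + y - 1) / 2)
      = s * (b * mallows_denom b x y) / 2"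
  proof -
    have e: "s * exp (- b * x) = exp (- b / 4 + - (b * (x + y - 1) / 2))"
      "s * exp (b * y) * exp (- b * x) = exp (b / 4 + - (b * (x - y) / 2))"
      "s * exp (b * y) * exp (- b) = exp (- b / 4 + b * (x + y - 1) / 2)"
      unfolding s_def by (simp_all add: exp_add[symmetric] field_simps)
    have "s * (b * mallows_denom b x y)
        = s - s * exp (- b * x) + s * exp (b * y) * exp (- b * x) - s * exp (b * y) * exp (- b)"
      unfolding times_mallows_denom by (simp add: algebra_simps)
    also have "\<dots> = exp (b / 4 + b * (x - y) / 2) - exp (- b / 4 + - (b * (x + y - 1) / 2))
        + exp (b / 4 + - (b * (x - y) / 2)) - exp (- b / 4 + b * (x + y - 1) / 2)"
      by (simp only: e) (simp only: s_def)
    finally show ?thesis unfolding exp_add cosh_def by (simp add: algebra_simps)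
  qed
  have "mallows_u x y b = (b / 2) * (exp (b / 2) * (b * exp_quot (- b)) / 2)
      / (s * (b * mallows_denom b x y) / 2)\<^sup>2"
    using False unfolding mallows_u_def denom sinh by simp
  also have "\<dots> = exp (b / 2) * exp_quot (- b) / (s\<^sup>2 * (mallows_denom b x y)\<^sup>2)"
    using False by (simp add: power2_eq_square field_simps)
  also have "\<dots> = exp_quot (- b) * (1 / exp (b * (x - y))) / (mallows_denom b x y)\<^sup>2"
    unfolding s by simp
  also have "1 / exp (b * (x - y)) = exp (b * (y - x))"
    by (simp add: field_simps exp_add[symmetric])
  finally show ?thesis .
qed

lemma mallows_u_nonneg: "mallows_u x y b \<ge> 0"
  unfolding mallows_u_eq using exp_quot_pos[of "- b"] by simp

lemma continuous_on_mallows_u: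
  assumes "continuous_on S b" "continuous_on S x" "continuous_on S y"
    and "\<And>z. z \<in> S \<Longrightarrow> x z \<in> {0..1}"
  shows "continuous_on S (\<lambda>z. mallows_u (x z) (y z) (b z))"
proof -
  have "mallows_denom (b z) (x z) (y z) \<noteq> 0" if "z \<in> S" for z
    using mallows_denom_pos[OF assms(4)[OF that], of "b z" "y z"] by simp
  moreover have "continuous_on S (\<lambda>z. mallows_denom (b z) (x z) (y z))"
    unfolding mallows_denom_def using assms(1-3) by (intro continuous_intros)
  ultimately show ?thesis
    unfolding mallows_u_eq using assms(1-3) by (intro continuous_intros) auto
qed

lemma DERIV_times_exp_quot: "((\<lambda>y. y * exp_quot (b * y)) has_real_derivative exp (b * y)) (at y)"
proof (cases "b = 0")
  case True
  then show ?thesis by simp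
next
  case False
  have "(\<lambda>y. y * exp_quot (b * y)) = (\<lambda>y. (exp (b * y) - 1) / b)"
  proof
    fix y
    have "b * (y * exp_quot (b * y)) = exp (b * y) - 1"
      using times_exp_quot[of "b * y"] by (simp add: mult_ac)
    then show "y * exp_quot (b * y) = (exp (b * y) - 1) / b" using False by (simp add: field_simps)
  qed
  moreover have "((\<lambda>y. (exp (b * y) - 1) / b) has_real_derivative exp (b * y)) (at y)"
    using False by (auto intro!: derivative_eq_intros)
  ultimately show ?thesis by simp
qed

lemma mallows_denom_0: "mallows_denom b x 0 = exp_quot (- b)"
proof (cases "b = 0")
  case True
  then show ?thesis unfolding mallows_denom_def by simp
next
  case False
  have "b * mallows_denom b x 0 = b * exp_quot (- b)"
    using times_mallows_denom[of b x 0] times_exp_quot[of "- b"] by simp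
  then show ?thesis using False by simp
qed

text \<open>With \<open>N = y * exp_quot (b * y)\<close> and \<open>P = mallows_denom b x y\<close>, the numerator of the quotient rule collapses,
because \<open>b * N = exp (b * y) - 1\<close> cancels all but \<open>exp (b * y)\<close> times the value of \<open>P\<close> at
\<open>y = 0\<close>.\<close>

lemma DERIV_mallows_cdf:
  assumes "x \<in> {0..1}"
  shows "((\<lambda>y. mallows_cdf b x y) has_real_derivative mallows_u x y b) (at y)"
proof -
  define Q where "Q = (1 - x) * exp_quot (b * (1 - x)) * exp (b * (y - 1))"
  have D: "mallows_denom b x y \<noteq> 0" using mallows_denom_pos[OF assms, of b y] by simp
  have dD: "((\<lambda>y. mallows_denom b x y) has_real_derivative b * Q) (at y)"
    unfolding mallows_denom_def Q_def by (auto intro!: derivative_eq_intros)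
  have "((\<lambda>y. mallows_cdf b x y) has_real_derivative
     (exp (b * y) * exp (- b * x) * mallows_denom b x y
       - y * exp_quot (b * y) * exp (- b * x) * (b * Q)) / (mallows_denom b x y * mallows_denom b x y)) (at y)"
    unfolding mallows_cdf_def
    by (rule DERIV_divide[OF DERIV_cmult_right[OF DERIV_times_exp_quot] dD D])
  moreover have "exp (b * y) * exp (- b * x) * mallows_denom b x y
       - y * exp_quot (b * y) * exp (- b * x) * (b * Q) = exp_quot (- b) * exp (b * (y - x))"
  proof -
    have "exp (b * y) * exp (- b * x) * mallows_denom b x y
       - y * exp_quot (b * y) * exp (- b * x) * (b * Q)
      = exp (- b * x) * (exp (b * y) * mallows_denom b x y - (b * y * exp_quot (b * y)) * Q)"
      by (simp add: algebra_simps)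
    also have "b * y * exp_quot (b * y) = exp (b * y) - 1" by (rule times_exp_quot)
    also have "exp (b * y) * mallows_denom b x y - (exp (b * y) - 1) * Q
        = exp (b * y) * (x * exp_quot (- b * x)) + Q"
      unfolding mallows_denom_def Q_def[symmetric] by (simp add: algebra_simps)
    also have "exp (b * y) * (x * exp_quot (- b * x)) + Q = exp (b * y) * mallows_denom b x 0"
    proof -
      have "exp (b * (y - 1)) = exp (b * y) * exp (b * (0 - 1))"
        by (simp add: algebra_simps exp_add[symmetric])
      then show ?thesis unfolding Q_def mallows_denom_def by (simp add: distrib_left mult_ac)
    qed
    also have "exp (- b * x) * (exp (b * y) * mallows_denom b x 0) = exp_quot (- b) * exp (b * (y - x))"
      unfolding mallows_denom_0 by (simp add: algebra_simps exp_add[symmetric])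
    finally show ?thesis .
  qed
  ultimately show ?thesis unfolding mallows_u_eq by (simp add: power2_eq_square)
qed

lemma mallows_cdf_0: "mallows_cdf b x 0 = 0"
  unfolding mallows_cdf_def by simp

lemma mallows_cdf_1:
  assumes "x \<in> {0..1}"
  shows "mallows_cdf b x 1 = 1"
proof (cases "b = 0")
  case True
  then show ?thesis unfolding mallows_cdf_def mallows_denom_def by simp
next
  case False
  have D: "mallows_denom b x 1 > 0" using mallows_denom_pos[OF assms] .
  have "b * (exp_quot b * exp (- b * x)) = (exp b - 1) * exp (- b * x)"
    using times_exp_quot[of b] by simp
  also have "\<dots> = b * mallows_denom b x 1"
  proof -
    have "exp b * exp (- b) = 1" by (simp flip: exp_add)
    then show ?thesis unfolding times_mallows_denom by (simp add: algebra_simps)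
  qed
  finally have "exp_quot b * exp (- b * x) = mallows_denom b x 1" using False by simp
  then show ?thesis using D unfolding mallows_cdf_def by simp
qed

lemma mallows_u_has_integral:
  assumes "x \<in> {0..1}" "s \<le> t"
  shows "((\<lambda>y. mallows_u x y b) has_integral mallows_cdf b x t - mallows_cdf b x s) {s..t}"
  using assms(2) DERIV_mallows_cdf[OF assms(1)]
  by (intro fundamental_theorem_of_calculus)
    (auto simp flip: has_real_derivative_iff_has_vector_derivative intro: DERIV_subset)

text \<open>No limit is involved: with \<open>q = exp (- b / n)\<close> the finite formula is the limiting one with
parameter \<open>b\<close>. Its convergence as \<open>n\<close> grows thereby reduces to continuity of the density in \<open>b\<close> and \<open>x\<close>.\<close>

lemma typical_cdf_eq_mallows_cdf:
  assumes q: "q > 0" and i: "1 \<le> i" "i \<le> n" and m: "m \<le> n"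
  shows "typical_cdf n q i m
    = mallows_cdf (- real n * ln q) (real (i - 1) / real n) (real m / real n)"
proof -
  define b where "b = - real n * ln q"
  define x where "x = real (i - 1) / real n"
  define y where "y = real m / real n"
  have n: "real n > 0" using i by simp
  have x: "x \<in> {0..1}" unfolding x_def using i n by (simp add: field_simps)
  have pow: "q ^ k = exp (- b * (real k / real n))" for k
  proof -
    have "q ^ k = exp (ln q) ^ k" using q by simp
    also have "\<dots> = exp (real k * ln q)" by (simp only: exp_of_nat_mult)
    finally show ?thesis using n unfolding b_def by (simp add: mult_ac)
  qed
  have k: "qnum q (Suc n - i) > 0" "qnum q n > 0" using i by (auto intro: qnum_pos q)
  show ?thesis
  proof (cases "q = 1")
    case True
    have [simp]: "qnum 1 r = real r" for r unfolding qnum_def by simp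
    have "typical_cdf n q i m = y"
      using True k n unfolding typical_cdf_def mean_qweight_def qweight_def y_def by simp
    moreover have "mallows_cdf b x y = y"
      using True unfolding mallows_cdf_def mallows_denom_def b_def by simp
    ultimately show ?thesis unfolding b_def x_def y_def by simp
  next
    case False
    have b0: "b \<noteq> 0" using False q n unfolding b_def by simp
    define a where "a = q ^ (i - 1)"
    define Y where "Y = 1 / q ^ m"
    define N where "N = q ^ n"
    define W where "W = qweight q m"
    define k' where "k' = Suc n - i"
    \<comment> \<open>All quantities are powers of \<open>q\<close> once the \<open>q\<close>-integers are multiplied by \<open>1 - q\<close>.\<close>
    have Nn: "(1 - q) * qnum q n = 1 - N" unfolding N_def by (rule qnum_geometric)
    have Wk: "(1 - q) * W = Y - 1"
      using one_plus_qweight[OF q, of m] unfolding W_def Y_def by simp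
    have ak: "a * ((1 - q) * qnum q k') = a - N"
    proof -
      have "N = a * q ^ k'" unfolding N_def a_def k'_def using i by (simp flip: power_add)
      then show ?thesis unfolding qnum_geometric by (simp add: right_diff_distrib)
    qed
    have N1: "1 - N \<noteq> 0" using Nn k False by auto
    have den: "b * mallows_denom b x y = 1 - a + Y * (a - N)"
      unfolding times_mallows_denom a_def Y_def N_def pow x_def y_def
      using n by (simp add: exp_minus field_simps)
    have den0: "1 - a + Y * (a - N) \<noteq> 0"
      using den b0 mallows_denom_pos[OF x, of b y] by (metis mult_eq_0_iff less_irrefl)
    have "typical_cdf n q i m = (W * a * qnum q k' / qnum q n) / (1 + (1 - q) * (W * a * qnum q k' / qnum q n)) / qnum q k'"
      unfolding typical_cdf_def mean_qweight_def W_def a_def k'_def ..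
    also have "\<dots> = (W * a / qnum q n) / (1 + (1 - q) * (W * a * qnum q k' / qnum q n))"
      using k unfolding k'_def by simp
    also have "W * a / qnum q n = (Y - 1) * a / (1 - N)"
      unfolding Nn[symmetric] Wk[symmetric] using False k by (simp add: field_simps)
    also have "(1 - q) * (W * a * qnum q k' / qnum q n) = (Y - 1) * (a - N) / (1 - N)"
      unfolding Nn[symmetric] Wk[symmetric] ak[symmetric] using False k by (simp add: field_simps)
    also have "1 + (Y - 1) * (a - N) / (1 - N) = (1 - a + Y * (a - N)) / (1 - N)"
      using N1 by (simp add: field_simps)
    also have "(Y - 1) * a / (1 - N) / ((1 - a + Y * (a - N)) / (1 - N)) = (Y - 1) * a / (b * mallows_denom b x y)"
      unfolding den using N1 by simp
    also have "(Y - 1) * a = b * (y * exp_quot (b * y) * exp (- b * x))"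
    proof -
      have "(b * y) * exp_quot (b * y) = Y - 1"
        unfolding times_exp_quot Y_def pow y_def by (simp add: exp_minus field_simps)
      moreover have "a = exp (- b * x)" unfolding a_def pow x_def ..
      ultimately show ?thesis by (simp add: mult_ac)
    qed
    finally show ?thesis using b0 unfolding mallows_cdf_def b_def[symmetric] x_def[symmetric] y_def[symmetric] by simp
  qed
qed

lemma typical_mean_eq_integral_sum:
  assumes q: "q > 0" and i: "1 \<le> i" "i \<le> n"
  shows "typical_mean n q i g = (\<Sum>m<n. g (Suc m) *
    integral {real m / n..real (Suc m) / n} (\<lambda>y. mallows_u (real (i - 1) / n) y (- real n * ln q)))"
  unfolding typical_mean_def
proof (intro sum.cong refl arg_cong2[where f = "(*)"])
  fix m assume "m \<in> {..<n}"
  then have m: "m < n" by simp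
  have "real (i - 1) / n \<in> {0..1}" using i by (simp add: field_simps)
  then have "integral {real m / n..real (Suc m) / n} (\<lambda>y. mallows_u (real (i - 1) / n) y (- real n * ln q))
    = mallows_cdf (- real n * ln q) (real (i - 1) / n) (real (Suc m) / n)
      - mallows_cdf (- real n * ln q) (real (i - 1) / n) (real m / n)"
    by (intro integral_unique mallows_u_has_integral) (auto simp: divide_right_mono)
  then show "typical_cdf n q i (Suc m) - typical_cdf n q i m
    = integral {real m / n..real (Suc m) / n} (\<lambda>y. mallows_u (real (i - 1) / n) y (- real n * ln q))"
    using typical_cdf_eq_mallows_cdf[OF q i] m by simp
qed

section \<open>The law of large numbers for continuous test functions\<close>

abbreviation (input) unit_square :: "(real \<times> real) set" where
  "unit_square \<equiv> {0..1} \<times> {0..1}"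

text \<open>At \<open>z = (x, t)\<close>, the mean of \<open>f (x, Y)\<close> where \<open>Y\<close> has the limiting law of the value at
relative position \<open>t\<close>.\<close>

definition mallows_average :: "real \<Rightarrow> (real \<times> real \<Rightarrow> real) \<Rightarrow> real \<times> real \<Rightarrow> real" where
  "mallows_average b f z = integral {0..1} (\<lambda>y. f (fst z, y) * mallows_u (snd z) y b)"

lemma continuous_on_section:
  assumes "continuous_on unit_square f" "x \<in> {0..1}"
  shows "continuous_on {0..1} (\<lambda>y. f (x, y))"
  using assms by (intro continuous_on_compose2[OF assms(1)] continuous_intros) auto

lemma continuous_on_mallows_u_snd:
  assumes "x \<in> {0..1}"
  shows "continuous_on S (\<lambda>y. mallows_u x y b)"
  using assms by (intro continuous_on_mallows_u continuous_intros) auto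

lemma continuous_on_mallows_average:
  assumes f: "continuous_on unit_square f"
  shows "continuous_on unit_square (mallows_average b f)"
proof -
  have "continuous_on (unit_square \<times> cbox 0 1) (\<lambda>(z, y). f (fst z, y) * mallows_u (snd z) y b)"
    unfolding case_prod_unfold
    by (intro continuous_on_mult continuous_on_compose2[OF f] continuous_on_mallows_u continuous_intros)
      auto
  from integral_continuous_on_param[OF this] show ?thesis
    unfolding mallows_average_def by simp
qed

lemma integral_abs_diff_le:
  fixes f g h :: "real \<Rightarrow> real"
  assumes "continuous_on {a..b} f" "continuous_on {a..b} g" "continuous_on {a..b} h"
    and "\<And>y. y \<in> {a..b} \<Longrightarrow> \<bar>f y - g y\<bar> \<le> h y"
  shows "\<bar>integral {a..b} f - integral {a..b} g\<bar> \<le> integral {a..b} h"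
proof -
  have i: "f integrable_on {a..b}" "g integrable_on {a..b}" "h integrable_on {a..b}"
    using assms by (simp_all add: integrable_continuous_interval)
  have "norm (integral {a..b} (\<lambda>y. f y - g y)) \<le> integral {a..b} h"
    using assms(4) i by (intro Henstock_Kurzweil_Integration.integral_norm_bound_integral integrable_diff) auto
  then show ?thesis using i by (simp add: Henstock_Kurzweil_Integration.integral_diff)
qed

lemma integral_mallows_u:
  assumes "x \<in> {0..1}"
  shows "integral {0..1} (\<lambda>y. mallows_u x y b) = 1"
  using mallows_u_has_integral[OF assms, of 0 1 b] mallows_cdf_0 mallows_cdf_1[OF assms]
  by (simp add: integral_unique)

lemma integral_equipartition:
  fixes f :: "real \<Rightarrow> real"
  assumes f: "continuous_on {0..1} f" and n: "n \<ge> 1"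
  shows "integral {0..1} f = (\<Sum>m<n. integral {real m / n..real (Suc m) / n} f)"
proof -
  have "integral {0..real k / n} f = (\<Sum>m<k. integral {real m / n..real (Suc m) / n} f)" if "k \<le> n" for k
    using that
  proof (induction k)
    case (Suc k)
    have "{0..real (Suc k) / n} \<subseteq> {0..1}" using Suc.prems n by (auto simp: field_simps)
    then have "f integrable_on {0..real (Suc k) / n}"
      using f by (intro integrable_continuous_interval) (rule continuous_on_subset)
    then have "integral {0..real k / n} f + integral {real k / n..real (Suc k) / n} f
        = integral {0..real (Suc k) / n} f"
      by (intro Henstock_Kurzweil_Integration.integral_combine) (auto simp: divide_right_mono)
    then show ?case using Suc by simp
  qed simp
  from this[of n] show ?thesis using n by simp
qed

text \<open>On each interval \<open>{m / n..(m + 1) / n}\<close> the function \<open>h\<close> differs from its value at the right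
end by at most \<open>L / n\<close>, and the density has total mass 1.\<close>

lemma typical_mean_approx:
  assumes q: "q > 0" and i: "1 \<le> i" "i \<le> n" and h: "continuous_on {0..1} h"
    and L: "\<And>y y'. y \<in> {0..1} \<Longrightarrow> y' \<in> {0..1} \<Longrightarrow> \<bar>h y - h y'\<bar> \<le> L * \<bar>y - y'\<bar>" and L0: "L \<ge> 0"
  shows "\<bar>typical_mean n q i (\<lambda>m. h (real m / n))
    - integral {0..1} (\<lambda>y. h y * mallows_u (real (i - 1) / n) y (- real n * ln q))\<bar> \<le> L / n"
proof -
  let ?u = "\<lambda>y. mallows_u (real (i - 1) / n) y (- real n * ln q)"
  let ?I = "\<lambda>m. {real m / n..real (Suc m) / n}"
  have n: "n \<ge> 1" "real n > 0" using i by auto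
  have x: "real (i - 1) / n \<in> {0..1}" using i by (simp add: field_simps)
  note u = continuous_on_mallows_u_snd[OF x]
  have sub: "?I m \<subseteq> {0..1}" if "m < n" for m
    using that by (simp add: field_simps)
  have "\<bar>typical_mean n q i (\<lambda>m. h (real m / n)) - integral {0..1} (\<lambda>y. h y * ?u y)\<bar>
    = \<bar>\<Sum>m<n. integral (?I m) (\<lambda>y. h (real (Suc m) / n) * ?u y) - integral (?I m) (\<lambda>y. h y * ?u y)\<bar>"
    unfolding typical_mean_eq_integral_sum[OF q i] sum_subtractf
    using integral_equipartition[OF continuous_on_mult[OF h u] n(1)] by simp
  also have "\<dots> \<le> (\<Sum>m<n. \<bar>integral (?I m) (\<lambda>y. h (real (Suc m) / n) * ?u y) - integral (?I m) (\<lambda>y. h y * ?u y)\<bar>)"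
    by (rule sum_abs)
  also have "\<dots> \<le> (\<Sum>m<n. integral (?I m) (\<lambda>y. L / n * ?u y))"
  proof (intro sum_mono integral_abs_diff_le continuous_on_mult u continuous_on_const)
    fix m assume "m \<in> {..<n}"
    then have m: "m < n" by simp
    show "continuous_on (?I m) h" using h sub[OF m] continuous_on_subset by blast
    fix y assume y: "y \<in> ?I m"
    have e: "real (Suc m) / n \<in> ?I m" by (simp add: divide_right_mono)
    have "\<bar>h (real (Suc m) / n) - h y\<bar> \<le> L * \<bar>real (Suc m) / n - y\<bar>"
      by (rule L[OF subsetD[OF sub[OF m] e] subsetD[OF sub[OF m] y]])
    also have "\<dots> \<le> L * (1 / n)"
    proof (rule mult_left_mono[OF _ L0])
      have "real (Suc m) / n - real m / n = 1 / n" by (simp add: diff_divide_distrib[symmetric])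
      then show "\<bar>real (Suc m) / n - y\<bar> \<le> 1 / n" using y by simp
    qed
    finally have "\<bar>h (real (Suc m) / n) - h y\<bar> * ?u y \<le> L / n * ?u y"
      using mallows_u_nonneg by (intro mult_right_mono) auto
    then show "\<bar>h (real (Suc m) / n) * ?u y - h y * ?u y\<bar> \<le> L / n * ?u y"
      using mallows_u_nonneg[of "real (i - 1) / n" y "- real n * ln q"]
      by (simp add: left_diff_distrib[symmetric] abs_mult)
  qed
  also have "\<dots> = integral {0..1} (\<lambda>y. L / n * ?u y)"
    by (rule integral_equipartition[symmetric, OF continuous_on_mult[OF continuous_on_const u] n(1)])
  also have "\<dots> = L / n"
    using integral_mallows_u[OF x] by (simp add: integral_mult_right del: times_divide_eq_left)
  finally show ?thesis .
qed

lemma bounded_on_unit_square: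
  assumes "continuous_on unit_square f"
  obtains B where "B \<ge> 0" "\<And>x y. x \<in> {0..1} \<Longrightarrow> y \<in> {0..1} \<Longrightarrow> \<bar>f (x, y)\<bar> \<le> (B :: real)"
proof -
  have "bounded (f ` unit_square)"
    using assms by (intro compact_imp_bounded compact_continuous_image compact_Times) auto
  then obtain B where B: "B > 0" "\<And>r. r \<in> f ` unit_square \<Longrightarrow> norm r \<le> B"
    unfolding bounded_pos by blast
  have "\<bar>f (x, y)\<bar> \<le> B" if "x \<in> {0..1}" "y \<in> {0..1}" for x y
    using B(2)[OF imageI, of "(x, y)"] that by simp
  then show ?thesis using B(1) by (intro that[of B]) auto
qed

text \<open>Polynomials are the dense class of test functions to which the quantitative law of large numbers,
which needs increments of order \<open>1 / n\<close>, applies.\<close>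

lemma real_polynomial_function_Lipschitz_snd:
  fixes g :: "real \<times> real \<Rightarrow> real"
  assumes "real_polynomial_function g"
  shows "\<exists>L\<ge>0. \<forall>x\<in>{0..1}. \<forall>y\<in>{0..1}. \<forall>y'\<in>{0..1}. \<bar>g (x, y) - g (x, y')\<bar> \<le> L * \<bar>y - y'\<bar>"
  using assms
proof (induction rule: real_polynomial_function.induct)
  case (linear g)
  then obtain K where K: "K > 0" "\<And>z. norm (g z) \<le> norm z * K"
    using bounded_linear.pos_bounded by blast
  have "\<bar>g (x, y) - g (x, y')\<bar> \<le> K * \<bar>y - y'\<bar>" for x y y'
  proof -
    have "g (x, y) - g (x, y') = g (0, y - y')"
      using linear_diff[OF bounded_linear.linear[OF linear], of "(x, y)" "(x, y')"] by simp
    then show ?thesis using K(2)[of "(0, y - y')"] by (simp add: norm_Pair mult.commute)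
  qed
  then show ?case using K(1) by (intro exI[of _ K]) auto
next
  case (const c)
  show ?case by (rule exI[of _ 0]) simp
next
  case (add f g)
  then obtain L L' where L: "L \<ge> 0" "L' \<ge> 0"
    and f: "\<forall>x\<in>{0..1}. \<forall>y\<in>{0..1}. \<forall>y'\<in>{0..1}. \<bar>f (x, y) - f (x, y')\<bar> \<le> L * \<bar>y - y'\<bar>"
    and g: "\<forall>x\<in>{0..1}. \<forall>y\<in>{0..1}. \<forall>y'\<in>{0..1}. \<bar>g (x, y) - g (x, y')\<bar> \<le> L' * \<bar>y - y'\<bar>" by blast
  show ?case
  proof (intro exI[of _ "L + L'"] conjI ballI)
    fix x y y' :: real assume "x \<in> {0..1}" "y \<in> {0..1}" "y' \<in> {0..1}"
    then have "\<bar>f (x, y) - f (x, y')\<bar> \<le> L * \<bar>y - y'\<bar>" "\<bar>g (x, y) - g (x, y')\<bar> \<le> L' * \<bar>y - y'\<bar>"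
      using f g by blast+
    then show "\<bar>(f (x, y) + g (x, y)) - (f (x, y') + g (x, y'))\<bar> \<le> (L + L') * \<bar>y - y'\<bar>"
      unfolding distrib_right by linarith
  qed (use L in simp)
next
  case (mult f g)
  then obtain L L' where L: "L \<ge> 0" "L' \<ge> 0"
    and f: "\<forall>x\<in>{0..1}. \<forall>y\<in>{0..1}. \<forall>y'\<in>{0..1}. \<bar>f (x, y) - f (x, y')\<bar> \<le> L * \<bar>y - y'\<bar>"
    and g: "\<forall>x\<in>{0..1}. \<forall>y\<in>{0..1}. \<forall>y'\<in>{0..1}. \<bar>g (x, y) - g (x, y')\<bar> \<le> L' * \<bar>y - y'\<bar>" by blast
  have cont: "continuous_on unit_square f" "continuous_on unit_square g"
    using mult.hyps by (auto intro!: continuous_at_imp_continuous_on continuous_real_polymonial_function)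
  obtain B where B: "B \<ge> 0" "\<And>x y. x \<in> {0..1} \<Longrightarrow> y \<in> {0..1} \<Longrightarrow> \<bar>f (x, y)\<bar> \<le> B"
    by (rule bounded_on_unit_square[OF cont(1)]) blast
  obtain B' where B': "B' \<ge> 0" "\<And>x y. x \<in> {0..1} \<Longrightarrow> y \<in> {0..1} \<Longrightarrow> \<bar>g (x, y)\<bar> \<le> B'"
    by (rule bounded_on_unit_square[OF cont(2)]) blast
  show ?case
  proof (intro exI[of _ "B * L' + L * B'"] conjI ballI)
    fix x y y' :: real assume *: "x \<in> {0..1}" "y \<in> {0..1}" "y' \<in> {0..1}"
    have fg: "\<bar>f (x, y) - f (x, y')\<bar> \<le> L * \<bar>y - y'\<bar>" "\<bar>g (x, y) - g (x, y')\<bar> \<le> L' * \<bar>y - y'\<bar>"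
      using f g * by blast+
    have "f (x, y) * g (x, y) - f (x, y') * g (x, y')
      = f (x, y) * (g (x, y) - g (x, y')) + (f (x, y) - f (x, y')) * g (x, y')"
      by (simp add: algebra_simps)
    also have "\<bar>\<dots>\<bar> \<le> \<bar>f (x, y)\<bar> * \<bar>g (x, y) - g (x, y')\<bar> + \<bar>f (x, y) - f (x, y')\<bar> * \<bar>g (x, y')\<bar>"
      by (rule order_trans[OF abs_triangle_ineq]) (simp add: abs_mult)
    also have "\<dots> \<le> B * (L' * \<bar>y - y'\<bar>) + (L * \<bar>y - y'\<bar>) * B'"
      using fg B B' L * by (intro add_mono mult_mono) auto
    also have "\<dots> = (B * L' + L * B') * \<bar>y - y'\<bar>" by (simp add: algebra_simps)
    finally show "\<bar>f (x, y) * g (x, y) - f (x, y') * g (x, y')\<bar> \<le> (B * L' + L * B') * \<bar>y - y'\<bar>" .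
  qed (use B B' L in simp)
qed

text \<open>Squeeze \<open>- ln q\<close> between \<open>1 - q\<close> and \<open>(1 - q) / q\<close>.\<close>

lemma tendsto_neg_n_ln:
  assumes q: "\<And>n. n \<ge> 1 \<Longrightarrow> q n > 0" and lim: "(\<lambda>n. real n * (1 - q n)) \<longlonglongrightarrow> b"
  shows "(\<lambda>n. - real n * ln (q n)) \<longlonglongrightarrow> b"
proof -
  have "(\<lambda>n. real n * (1 - q n) * (1 / real n)) \<longlonglongrightarrow> b * 0"
    by (intro tendsto_mult lim lim_1_over_n)
  then have "(\<lambda>n. 1 - real n * (1 - q n) * (1 / real n)) \<longlonglongrightarrow> 1 - b * 0"
    by (intro tendsto_diff tendsto_const)
  moreover have "\<forall>\<^sub>F n in sequentially. 1 - real n * (1 - q n) * (1 / real n) = q n"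
    using eventually_gt_at_top[of 0] by eventually_elim simp
  ultimately have q1: "q \<longlonglongrightarrow> 1" by (simp add: tendsto_cong)
  have "(\<lambda>n. real n * (1 - q n) / q n) \<longlonglongrightarrow> b / 1"
    by (intro tendsto_divide lim q1) simp
  then have up: "(\<lambda>n. real n * (1 - q n) / q n) \<longlonglongrightarrow> b" by simp
  show ?thesis
  proof (rule tendsto_sandwich[OF _ _ lim up])
    show "\<forall>\<^sub>F n in sequentially. real n * (1 - q n) \<le> - real n * ln (q n)"
      using eventually_ge_at_top[of 1]
    proof eventually_elim
      case (elim n)
      have "real n * ln (q n) \<le> real n * (q n - 1)"
        using ln_le_minus_one[OF q[OF elim]] by (intro mult_left_mono) auto
      then show ?case by (simp add: algebra_simps)
    qed
    show "\<forall>\<^sub>F n in sequentially. - real n * ln (q n) \<le> real n * (1 - q n) / q n"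
      using eventually_ge_at_top[of 1]
    proof eventually_elim
      case (elim n)
      have "ln (1 / q n) \<le> 1 / q n - 1" using q[OF elim] by (intro ln_le_minus_one) simp
      then have "real n * (- ln (q n)) \<le> real n * (1 / q n - 1)"
        using q[OF elim] by (intro mult_left_mono) (auto simp: ln_div)
      also have "\<dots> = real n * (1 - q n) / q n" using q[OF elim] by (simp add: field_simps)
      finally show ?case by simp
    qed
  qed
qed

text \<open>Joint uniform continuity of the density on a compact set of parameters and points absorbs both the
varying parameter and the shift from \<open>(i - 1) / n\<close>, which comes from the exact formula, to
\<open>i / n\<close>.\<close>

lemma mallows_u_uniform_limit:
  assumes b: "b \<longlonglongrightarrow> \<beta>" and e: "e > 0"
  shows "\<forall>\<^sub>F n in sequentially. \<forall>i\<in>{1..n}. \<forall>y\<in>{0..1}.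
    \<bar>mallows_u (real (i - 1) / n) y (b n) - mallows_u (real i / n) y \<beta>\<bar> \<le> e"
proof -
  let ?K = "{\<beta> - 1..\<beta> + 1} \<times> unit_square"
  let ?U = "\<lambda>z. mallows_u (fst (snd z)) (snd (snd z)) (fst z)"
  have "continuous_on ?K ?U" by (intro continuous_on_mallows_u continuous_intros) auto
  moreover have "compact ?K" by (intro compact_Times) auto
  ultimately have "uniformly_continuous_on ?K ?U" by (intro compact_uniformly_continuous)
  then obtain d where d: "d > 0"
    "\<And>z z'. z \<in> ?K \<Longrightarrow> z' \<in> ?K \<Longrightarrow> dist z' z < d \<Longrightarrow> dist (?U z') (?U z) < e"
    unfolding uniformly_continuous_on_def using e by meson
  have b1: "\<forall>\<^sub>F n in sequentially. dist (b n) \<beta> < min 1 (d / 2)"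
    by (intro tendstoD[OF b]) (use d in simp)
  have n1: "\<forall>\<^sub>F n in sequentially. dist (1 / real n) 0 < d / 2"
    by (intro tendstoD[OF lim_1_over_n]) (use d in simp)
  show ?thesis using b1 n1 eventually_ge_at_top[of 1]
  proof eventually_elim
    case (elim n)
    show ?case
    proof (intro ballI)
      fix i y assume i: "i \<in> {1..n}" and y: "y \<in> {0..1::real}"
      let ?z' = "(b n, real (i - 1) / n, y)" and ?z = "(\<beta>, real i / n, y)"
      have "?z' \<in> ?K" "?z \<in> ?K"
        using elim(1) i y by (auto simp: dist_real_def field_simps abs_if split: if_splits)
      moreover have "dist ?z' ?z < d"
      proof -
        have "real (i - 1) / n - real i / n = - (1 / n)"
          using i by (simp add: of_nat_diff diff_divide_distrib[symmetric])
        then have "dist (real (i - 1) / n) (real i / n) = 1 / n" by (simp add: dist_real_def)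
        then have "dist (real (i - 1) / n, y) (real i / n, y) < d / 2"
          using elim(2) by (simp add: dist_Pair_Pair)
        moreover have "dist (b n) \<beta> < d / 2" using elim(1) by simp
        moreover have "dist ?z' ?z \<le> dist (b n) \<beta> + dist (real (i - 1) / n, y) (real i / n, y)"
          unfolding dist_Pair_Pair[of "b n"] by (rule sqrt_sum_squares_le_sum) auto
        ultimately show ?thesis by linarith
      qed
      ultimately have "dist (?U ?z') (?U ?z) < e" by (intro d(2))
      then show "\<bar>mallows_u (real (i - 1) / n) y (b n) - mallows_u (real i / n) y \<beta>\<bar> \<le> e"
        by (simp add: dist_real_def)
    qed
  qed
qed

text \<open>The first coordinates \<open>x j\<close> are arbitrary and the estimate is uniform in them. This uniformity is what
makes the law of large numbers applicable to a composition, where they are determined by the other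
permutation.\<close>

definition mallows_LLN_for :: "(nat \<Rightarrow> real) \<Rightarrow> real \<Rightarrow> (real \<times> real \<Rightarrow> real) \<Rightarrow> bool" where
  "mallows_LLN_for q b f \<longleftrightarrow> (\<forall>e>0. \<forall>\<^sub>F n in sequentially. \<forall>x. (\<forall>j\<in>{1..n}. x j \<in> {0..1}) \<longrightarrow>
     mallows_E n (q n) (\<lambda>p. \<bar>1 / n * (\<Sum>j=1..n. f (x j, real (p j) / n))
       - 1 / n * (\<Sum>j=1..n. mallows_average b f (x j, real j / n))\<bar>) \<le> e)"

lemma abs_mean_diff_le:
  fixes a b :: "nat \<Rightarrow> real"
  assumes "\<And>j. j \<in> {1..n} \<Longrightarrow> \<bar>a j - b j\<bar> \<le> c" "n \<ge> 1"
  shows "\<bar>1 / n * (\<Sum>j=1..n. a j) - 1 / n * (\<Sum>j=1..n. b j)\<bar> \<le> c"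
proof -
  have "\<bar>(\<Sum>j=1..n. a j) - (\<Sum>j=1..n. b j)\<bar> \<le> (\<Sum>j=1..n. \<bar>a j - b j\<bar>)"
    unfolding sum_subtractf[symmetric] by (rule sum_abs)
  also have "\<dots> \<le> (\<Sum>j=1..n. c)" by (rule sum_mono) (rule assms)
  also have "\<dots> = real n * c" by simp
  finally have "\<bar>(\<Sum>j=1..n. a j) - (\<Sum>j=1..n. b j)\<bar> \<le> real n * c" .
  moreover have "\<bar>1 / n * (\<Sum>j=1..n. a j) - 1 / n * (\<Sum>j=1..n. b j)\<bar>
      = \<bar>(\<Sum>j=1..n. a j) - (\<Sum>j=1..n. b j)\<bar> / n"
    by (simp flip: diff_divide_distrib)
  ultimately show ?thesis using assms(2) by (simp add: divide_le_eq mult.commute)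
qed

lemma mallows_LLN_Lipschitz:
  assumes q: "\<And>n. n \<ge> 1 \<Longrightarrow> q n > 0" and lim: "(\<lambda>n. real n * (1 - q n)) \<longlonglongrightarrow> b"
    and f: "continuous_on unit_square f"
    and L: "\<And>x y y'. x \<in> {0..1} \<Longrightarrow> y \<in> {0..1} \<Longrightarrow> y' \<in> {0..1} \<Longrightarrow>
      \<bar>f (x, y) - f (x, y')\<bar> \<le> L * \<bar>y - y'\<bar>" and L0: "L \<ge> 0"
  shows "mallows_LLN_for q b f"
  unfolding mallows_LLN_for_def
proof (intro allI impI)
  fix e :: real assume e: "e > 0"
  obtain B where B: "B \<ge> 0" "\<And>x y. x \<in> {0..1} \<Longrightarrow> y \<in> {0..1} \<Longrightarrow> \<bar>f (x, y)\<bar> \<le> B"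
    by (rule bounded_on_unit_square[OF f]) blast
  define \<beta> where "\<beta> = (\<lambda>n. - real n * ln (q n))"
  \<comment> \<open>Eventually \<open>q n ^ k = exp (- \<beta> n * k / n)\<close> with \<open>\<bar>\<beta> n\<bar> \<le> \<bar>b\<bar> + 1\<close>.\<close>
  define M where "M = exp (\<bar>b\<bar> + 1)"
  have \<beta>: "\<beta> \<longlonglongrightarrow> b" unfolding \<beta>_def by (rule tendsto_neg_n_ln[OF q lim])
  let ?err = "\<lambda>n. B / sqrt (real n) + L * M ^ 4 * (harm n / sqrt (real n)) + L * (1 / real n)"
  have "filterlim (\<lambda>n. sqrt (real n)) at_infinity sequentially"
    by (intro filterlim_at_top_imp_at_infinity filterlim_compose[OF sqrt_at_top filterlim_real_sequentially])
  then have "(\<lambda>n. B / sqrt (real n)) \<longlonglongrightarrow> 0" by (rule tendsto_divide_0[OF tendsto_const])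
  then have "?err \<longlonglongrightarrow> 0 + L * M ^ 4 * 0 + L * 0"
    by (intro tendsto_add tendsto_mult tendsto_const harm_over_sqrt_tendsto_0 lim_1_over_n)
  then have err: "\<forall>\<^sub>F n in sequentially. ?err n < e / 2"
    using e by (intro order_tendstoD(2)) auto
  have bdd: "\<forall>\<^sub>F n in sequentially. dist (\<beta> n) b < 1"
    by (intro tendstoD[OF \<beta>]) simp
  \<comment> \<open>The summand 1 keeps the denominator positive when \<open>B = 0\<close>.\<close>
  have "e / 2 / (B + 1) > 0" using e B(1) by simp
  from mallows_u_uniform_limit[OF \<beta> this]
  have u: "\<forall>\<^sub>F n in sequentially. \<forall>i\<in>{1..n}. \<forall>y\<in>{0..1}.
    \<bar>mallows_u (real (i - 1) / n) y (\<beta> n) - mallows_u (real i / n) y b\<bar> \<le> e / 2 / (B + 1)" .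
  show "\<forall>\<^sub>F n in sequentially. \<forall>x. (\<forall>j\<in>{1..n}. x j \<in> {0..1}) \<longrightarrow>
     mallows_E n (q n) (\<lambda>p. \<bar>1 / n * (\<Sum>j=1..n. f (x j, real (p j) / n))
       - 1 / n * (\<Sum>j=1..n. mallows_average b f (x j, real j / n))\<bar>) \<le> e"
    using err bdd u eventually_ge_at_top[of 1]
  proof eventually_elim
    case (elim n)
    have qn: "q n > 0" using q elim(4) .
    have n: "real n > 0" using elim(4) by simp
    have cancel: "c * (d / c) = d" if "c \<noteq> 0" for c d :: real using that by simp
    have M: "1 / q n ^ k \<le> M" "q n ^ k \<le> M" if "k \<le> n" for k
    proof -
      have "\<bar>real k * ln (q n)\<bar> \<le> \<bar>\<beta> n\<bar>"
        unfolding \<beta>_def using that by (simp add: abs_mult mult_right_mono)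
      also have "\<dots> \<le> \<bar>b\<bar> + 1" using elim(2) by (simp add: dist_real_def)
      finally have "exp (real k * ln (q n)) \<le> M" "exp (- (real k * ln (q n))) \<le> M"
        unfolding M_def by (simp_all only: exp_le_cancel_iff)
      moreover have "exp (real k * ln (q n)) = q n ^ k" using qn by (simp add: exp_of_nat_mult)
      ultimately show "1 / q n ^ k \<le> M" "q n ^ k \<le> M" by (simp_all add: exp_minus inverse_eq_divide)
    qed
    show ?case
    proof (intro allI impI)
      fix x :: "nat \<Rightarrow> real" assume x: "\<forall>j\<in>{1..n}. x j \<in> {0..1}"
      define g where "g = (\<lambda>j m. f (x j, real m / n))"
      let ?T = "1 / n * (\<Sum>j=1..n. typical_mean n (q n) j (g j))"
      let ?A = "1 / n * (\<Sum>j=1..n. mallows_average b f (x j, real j / n))"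
      have unit: "real m / n \<in> {0..1}" if "m \<le> n" for m using that n by simp
      have random: "mallows_E n (q n) (\<lambda>p. \<bar>1 / n * (\<Sum>j=1..n. g j (p j)) - ?T\<bar>)
          \<le> B / sqrt n + L * M ^ 4 * (harm n / sqrt n)"
      proof (rule mallows_LLN[OF qn M])
        fix j m assume "j \<in> {1..n}" "m \<in> {1..n}"
        then show "\<bar>g j m\<bar> \<le> B" unfolding g_def using x unit by (intro B(2)) auto
      next
        fix j m assume *: "j \<in> {1..n}" "1 \<le> m" "m < n"
        then have "\<bar>g j (Suc m) - g j m\<bar> \<le> L * \<bar>real (Suc m) / n - real m / n\<bar>"
          unfolding g_def using x by (intro L unit) auto
        also have "real (Suc m) / n - real m / n = 1 / n" by (simp flip: diff_divide_distrib)
        finally show "\<bar>g j (Suc m) - g j m\<bar> \<le> L / n" by simp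
      qed (use L0 elim in auto)
      have "\<bar>?T - ?A\<bar> \<le> L * (1 / n) + e / 2"
      proof (rule abs_mean_diff_le[OF _ elim(4)])
        fix j assume j: "j \<in> {1..n}"
        let ?h = "\<lambda>y. f (x j, y)"
        let ?u = "\<lambda>y. mallows_u (real (j - 1) / n) y (\<beta> n)" and ?v = "\<lambda>y. mallows_u (real j / n) y b"
        have xj: "x j \<in> {0..1}" using x j by blast
        have h: "continuous_on {0..1} ?h" by (rule continuous_on_section[OF f xj])
        have cont: "continuous_on {0..1} ?u" "continuous_on {0..1} ?v"
          using j unit by (auto intro!: continuous_on_mallows_u_snd)
        have "\<bar>typical_mean n (q n) j (g j) - integral {0..1} (\<lambda>y. ?h y * ?u y)\<bar> \<le> L / n"
          unfolding g_def \<beta>_def using j by (intro typical_mean_approx qn h L xj L0) auto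
        moreover have "\<bar>integral {0..1} (\<lambda>y. ?h y * ?u y) - integral {0..1} (\<lambda>y. ?h y * ?v y)\<bar>
            \<le> integral {0..1} (\<lambda>y::real. e / 2)"
        proof (intro integral_abs_diff_le continuous_on_mult h cont continuous_on_const)
          fix y :: real assume y: "y \<in> {0..1}"
          have "\<bar>?h y * ?u y - ?h y * ?v y\<bar> = \<bar>?h y\<bar> * \<bar>?u y - ?v y\<bar>"
            by (simp add: abs_mult flip: right_diff_distrib)
          also have "\<dots> \<le> (B + 1) * (e / 2 / (B + 1))"
            using B(2)[OF xj y] elim(3) j y B(1) by (intro mult_mono) auto
          also have "\<dots> = e / 2" by (rule cancel) (use B(1) in simp)
          finally show "\<bar>?h y * ?u y - ?h y * ?v y\<bar> \<le> e / 2" .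
        qed
        moreover have "integral {0..1} (\<lambda>y::real. e / 2) = e / 2" "L * (1 / n) = L / n" by simp_all
        ultimately show "\<bar>typical_mean n (q n) j (g j) - mallows_average b f (x j, real j / n)\<bar>
            \<le> L * (1 / n) + e / 2"
          unfolding mallows_average_def fst_conv snd_conv by linarith
      qed
      then have "mallows_E n (q n) (\<lambda>p. \<bar>1 / n * (\<Sum>j=1..n. g j (p j)) - ?A\<bar>)
        \<le> mallows_E n (q n) (\<lambda>p. \<bar>1 / n * (\<Sum>j=1..n. g j (p j)) - ?T\<bar> + (L * (1 / n) + e / 2))"
        by (intro mallows_E_mono) linarith
      also have "\<dots> = mallows_E n (q n) (\<lambda>p. \<bar>1 / n * (\<Sum>j=1..n. g j (p j)) - ?T\<bar>) + (L * (1 / n) + e / 2)"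
        unfolding mallows_E_add mallows_E_const[OF qn] ..
      also have "\<dots> \<le> e" using random elim(1) by linarith
      finally show "mallows_E n (q n) (\<lambda>p. \<bar>1 / n * (\<Sum>j=1..n. f (x j, real (p j) / n)) - ?A\<bar>) \<le> e"
        unfolding g_def .
    qed
  qed
qed

lemma mallows_average_diff_le:
  assumes f: "continuous_on unit_square f" and g: "continuous_on unit_square g"
    and fg: "\<And>z. z \<in> unit_square \<Longrightarrow> \<bar>f z - g z\<bar> \<le> e" and z: "z \<in> unit_square"
  shows "\<bar>mallows_average b f z - mallows_average b g z\<bar> \<le> e"
proof -
  obtain x t where xt: "z = (x, t)" "x \<in> {0..1}" "t \<in> {0..1}" using z by auto
  note u = continuous_on_mallows_u_snd[OF xt(3)]
  have "\<bar>mallows_average b f z - mallows_average b g z\<bar> \<le> integral {0..1} (\<lambda>y. e * mallows_u t y b)"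
    unfolding mallows_average_def xt(1) fst_conv snd_conv
  proof (intro integral_abs_diff_le continuous_on_mult u continuous_on_const continuous_on_section f g xt)
    fix y :: real assume y: "y \<in> {0..1}"
    have "\<bar>f (x, y) - g (x, y)\<bar> * mallows_u t y b \<le> e * mallows_u t y b"
      using fg[of "(x, y)"] xt y mallows_u_nonneg by (intro mult_right_mono) auto
    then show "\<bar>f (x, y) * mallows_u t y b - g (x, y) * mallows_u t y b\<bar> \<le> e * mallows_u t y b"
      using mallows_u_nonneg[of t y b] by (simp add: abs_mult flip: left_diff_distrib)
  qed
  also have "\<dots> = e" using integral_mallows_u[OF xt(3)] by simp
  finally show ?thesis .
qed

text \<open>Both the empirical mean and the limiting mean move by at most \<open>e\<close> when the test function moves by
at most \<open>e\<close> on the square, so uniform approximation by polynomials extends the Lipschitz case.\<close>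

lemma mallows_LLN_continuous:
  assumes q: "\<And>n. n \<ge> 1 \<Longrightarrow> q n > 0" and lim: "(\<lambda>n. real n * (1 - q n)) \<longlonglongrightarrow> b"
    and f: "continuous_on unit_square f"
  shows "mallows_LLN_for q b f"
  unfolding mallows_LLN_for_def
proof (intro allI impI)
  fix e :: real assume e: "e > 0"
  have "compact unit_square" by (intro compact_Times) auto
  from Stone_Weierstrass_real_polynomial_function[OF this f, of "e / 3"] e
  obtain g where g: "real_polynomial_function g" "\<And>z. z \<in> unit_square \<Longrightarrow> \<bar>f z - g z\<bar> < e / 3"
    by auto
  have gc: "continuous_on unit_square g"
    using g(1) by (intro continuous_at_imp_continuous_on ballI continuous_real_polymonial_function)
  obtain L where L: "L \<ge> 0" "\<forall>x\<in>{0..1}. \<forall>y\<in>{0..1}. \<forall>y'\<in>{0..1}. \<bar>g (x, y) - g (x, y')\<bar> \<le> L * \<bar>y - y'\<bar>"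
    using real_polynomial_function_Lipschitz_snd[OF g(1)] by blast
  have e3: "e / 3 > 0" using e by simp
  have "mallows_LLN_for q b g"
    using L by (intro mallows_LLN_Lipschitz[OF q lim gc, of L]) auto
  then have "\<forall>\<^sub>F n in sequentially. \<forall>x. (\<forall>j\<in>{1..n}. x j \<in> {0..1}) \<longrightarrow>
     mallows_E n (q n) (\<lambda>p. \<bar>1 / n * (\<Sum>j=1..n. g (x j, real (p j) / n))
       - 1 / n * (\<Sum>j=1..n. mallows_average b g (x j, real j / n))\<bar>) \<le> e / 3"
    unfolding mallows_LLN_for_def using e3 by blast
  then show "\<forall>\<^sub>F n in sequentially. \<forall>x. (\<forall>j\<in>{1..n}. x j \<in> {0..1}) \<longrightarrow>
     mallows_E n (q n) (\<lambda>p. \<bar>1 / n * (\<Sum>j=1..n. f (x j, real (p j) / n))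
       - 1 / n * (\<Sum>j=1..n. mallows_average b f (x j, real j / n))\<bar>) \<le> e"
    using eventually_ge_at_top[of 1]
  proof eventually_elim
    case (elim n)
    have qn: "q n > 0" using q elim(2) .
    have unit: "real m / n \<in> {0..1}" if "m \<le> n" for m using that elim(2) by simp
    show ?case
    proof (intro allI impI)
      fix x :: "nat \<Rightarrow> real" assume x: "\<forall>j\<in>{1..n}. x j \<in> {0..1}"
      let ?S = "\<lambda>h p. 1 / n * (\<Sum>j=1..n. h (x j, real (p j) / n))"
      let ?A = "\<lambda>h. 1 / n * (\<Sum>j=1..n. mallows_average b h (x j, real j / n))"
      have average: "\<bar>?A f - ?A g\<bar> \<le> e / 3"
        using x unit g(2) by (intro abs_mean_diff_le[OF _ elim(2)] mallows_average_diff_le f gc) (auto intro: less_imp_le)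
      have sample: "\<bar>?S f p - ?S g p\<bar> \<le> e / 3" if p: "p permutes {1..n}" for p
      proof (rule abs_mean_diff_le[OF _ elim(2)])
        fix j assume j: "j \<in> {1..n}"
        then have "p j \<le> n" using permutes_in_image[OF p, of j] by simp
        then have "(x j, real (p j) / n) \<in> unit_square" using x unit j by auto
        then show "\<bar>f (x j, real (p j) / n) - g (x j, real (p j) / n)\<bar> \<le> e / 3"
          using g(2) by (intro less_imp_le)
      qed
      have "\<bar>?S f p - ?A f\<bar> \<le> \<bar>?S g p - ?A g\<bar> + 2 * e / 3" if "p permutes {1..n}" for p
        using sample[OF that] average by linarith
      then have "mallows_E n (q n) (\<lambda>p. \<bar>?S f p - ?A f\<bar>)
          \<le> mallows_E n (q n) (\<lambda>p. \<bar>?S g p - ?A g\<bar> + 2 * e / 3)"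
        by (rule mallows_E_mono)
      also have "\<dots> = mallows_E n (q n) (\<lambda>p. \<bar>?S g p - ?A g\<bar>) + 2 * e / 3"
        unfolding mallows_E_add mallows_E_const[OF qn] ..
      also have "\<dots> \<le> e" using elim(1) x by fastforce
      finally show "mallows_E n (q n) (\<lambda>p. \<bar>?S f p - ?A f\<bar>) \<le> e" .
    qed
  qed
qed

section \<open>Composition of two independent Mallows permutations\<close>

lemma right_Riemann_sum_tendsto:
  fixes f :: "real \<Rightarrow> real"
  assumes f: "continuous_on {0..1} f"
  shows "(\<lambda>n. 1 / real n * (\<Sum>i=1..n. f (real i / n))) \<longlonglongrightarrow> integral {0..1} f"
proof (rule tendstoI)
  fix e :: real assume e: "e > 0"
  have "uniformly_continuous_on {0..1} f"
    by (rule compact_uniformly_continuous[OF f]) simp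
  then obtain d where d: "d > 0"
    "\<And>x y. x \<in> {0..1} \<Longrightarrow> y \<in> {0..1} \<Longrightarrow> dist y x < d \<Longrightarrow> dist (f y) (f x) < e / 2"
    unfolding uniformly_continuous_on_def using e by (metis half_gt_zero)
  have "\<forall>\<^sub>F n in sequentially. dist (1 / real n) 0 < d" by (intro tendstoD[OF lim_1_over_n] d)
  then show "\<forall>\<^sub>F n in sequentially. dist (1 / real n * (\<Sum>i=1..n. f (real i / n))) (integral {0..1} f) < e"
    using eventually_ge_at_top[of 1]
  proof eventually_elim
    case (elim n)
    let ?I = "\<lambda>m. {real m / n..real (Suc m) / n}"
    have n: "real n > 0" using elim(2) by simp
    have len: "real (Suc m) / n - real m / n = 1 / n" for m by (simp flip: diff_divide_distrib)
    have const: "integral (?I m) (\<lambda>y. c) = 1 / n * c" for m c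
      using len[of m] n by (simp add: divide_right_mono)
    have sub: "?I m \<subseteq> {0..1}" if "m < n" for m using that n by (simp add: field_simps)
    have "(\<Sum>i=1..n. f (real i / n)) = (\<Sum>m<n. f (real (Suc m) / n))"
      by (rule sum.reindex_bij_witness[of _ Suc "\<lambda>i. i - 1"]) auto
    then have "\<bar>1 / real n * (\<Sum>i=1..n. f (real i / n)) - integral {0..1} f\<bar>
       = \<bar>\<Sum>m<n. integral (?I m) (\<lambda>y. f (real (Suc m) / n)) - integral (?I m) f\<bar>"
      unfolding sum_subtractf const integral_equipartition[OF f elim(2)] by (simp add: sum_divide_distrib)
    also have "\<dots> \<le> (\<Sum>m<n. \<bar>integral (?I m) (\<lambda>y. f (real (Suc m) / n)) - integral (?I m) f\<bar>)"
      by (rule sum_abs)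
    also have "\<dots> \<le> (\<Sum>m<n. integral (?I m) (\<lambda>y. e / 2))"
    proof (intro sum_mono integral_abs_diff_le continuous_on_const)
      fix m assume "m \<in> {..<n}"
      then have m: "m < n" by simp
      show "continuous_on (?I m) f" using f sub[OF m] continuous_on_subset by blast
      fix y assume y: "y \<in> ?I m"
      have e: "real (Suc m) / n \<in> ?I m" by (simp add: divide_right_mono)
      have "dist (real (Suc m) / n) y < d"
        using y len[of m] elim(1) by (simp add: dist_real_def)
      then have "dist (f (real (Suc m) / n)) (f y) < e / 2"
        by (rule d(2)[OF subsetD[OF sub[OF m] y] subsetD[OF sub[OF m] e]])
      then show "\<bar>f (real (Suc m) / n) - f y\<bar> \<le> e / 2" by (simp add: dist_real_def)
    qed
    also have "\<dots> = e / 2" unfolding const using n by simp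
    also have "\<dots> < e" using e by simp
    finally show ?case by (simp add: dist_real_def)
  qed
qed

lemma continuous_on_mallows_rho:
  "continuous_on unit_square (\<lambda>z. mallows_rho \<beta> \<gamma> (fst z) (snd z))"
proof -
  have "continuous_on (unit_square \<times> cbox 0 1)
      (\<lambda>(z, t). mallows_u (fst z) t \<beta> * mallows_u t (snd z) \<gamma>)"
    unfolding case_prod_unfold
    by (intro continuous_on_mult continuous_on_mallows_u continuous_intros) auto
  from integral_continuous_on_param[OF this] show ?thesis
    unfolding mallows_rho_def by simp
qed

text \<open>Fubini, first in \<open>(t, y)\<close> for fixed \<open>x\<close>, which turns the inner integral over \<open>t\<close> into
\<open>mallows_rho\<close>, then in \<open>(x, y)\<close>.\<close>

lemma iterated_mallows_average_eq:
  assumes f: "continuous_on unit_square f"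
  shows "integral {0..1} (\<lambda>x. mallows_average \<beta> (mallows_average \<gamma> f) (x, x))
    = integral {0..1} (\<lambda>y. integral {0..1} (\<lambda>x. f (x, y) * mallows_rho \<beta> \<gamma> x y))"
proof -
  have inner: "mallows_average \<beta> (mallows_average \<gamma> f) (x, x)
      = integral {0..1} (\<lambda>y. f (x, y) * mallows_rho \<beta> \<gamma> x y)" if x: "x \<in> {0..1}" for x
  proof -
    have c: "continuous_on (cbox (0, 0) (1, 1)) (\<lambda>(t, y). f (x, y) * mallows_u t y \<gamma> * mallows_u x t \<beta>)"
      unfolding case_prod_unfold
      by (intro continuous_on_mult continuous_on_compose2[OF f] continuous_on_mallows_u continuous_intros)
        (use x in auto)
    have "mallows_average \<beta> (mallows_average \<gamma> f) (x, x)
      = integral (cbox 0 1) (\<lambda>t. integral (cbox 0 1) (\<lambda>y. f (x, y) * mallows_u t y \<gamma> * mallows_u x t \<beta>))"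
      unfolding mallows_average_def by simp
    also have "\<dots> = integral (cbox 0 1) (\<lambda>y. integral (cbox 0 1) (\<lambda>t. f (x, y) * mallows_u t y \<gamma> * mallows_u x t \<beta>))"
      by (rule integral_swap_continuous[OF c])
    also have "\<dots> = integral {0..1} (\<lambda>y. f (x, y) * mallows_rho \<beta> \<gamma> x y)"
      unfolding mallows_rho_def by (simp add: mult_ac flip: integral_mult_right)
    finally show ?thesis .
  qed
  have c: "continuous_on (cbox (0, 0) (1, 1)) (\<lambda>(x, y). f (x, y) * mallows_rho \<beta> \<gamma> x y)"
    using continuous_on_mult[OF f continuous_on_mallows_rho[of \<beta> \<gamma>]]
    by (simp add: case_prod_unfold cbox_Pair_eq)
  have "integral {0..1} (\<lambda>x. mallows_average \<beta> (mallows_average \<gamma> f) (x, x))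
      = integral {0..1} (\<lambda>x. integral {0..1} (\<lambda>y. f (x, y) * mallows_rho \<beta> \<gamma> x y))"
    by (intro integral_cong inner)
  also have "\<dots> = integral {0..1} (\<lambda>y. integral {0..1} (\<lambda>x. f (x, y) * mallows_rho \<beta> \<gamma> x y))"
    using integral_swap_continuous[OF c] by simp
  finally show ?thesis .
qed

text \<open>Markov's inequality, in terms of finite sums.\<close>

lemma prob_pair_mallows_le:
  assumes q: "q > 0" "q' > 0" and \<epsilon>: "\<epsilon> > 0"
  shows "measure_pmf.prob (pair_pmf (mallows n q) (mallows n q')) {(\<pi>, \<tau>). \<bar>X \<pi> \<tau>\<bar> > \<epsilon>}
    \<le> mallows_E n q (\<lambda>\<pi>. mallows_E n q' (\<lambda>\<tau>. \<bar>X \<pi> \<tau>\<bar>)) / \<epsilon>"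
proof -
  let ?P = "pair_pmf (mallows n q) (mallows n q')" and ?A = "{(\<pi>, \<tau>). \<bar>X \<pi> \<tau>\<bar> > \<epsilon>}"
  let ?S = "{p. p permutes {1..n}}"
  have fin: "finite (?S \<times> ?S)" by (simp add: finite_permutations)
  have sup: "set_pmf ?P \<subseteq> ?S \<times> ?S"
    using q by (auto simp: set_pmf_iff pmf_mallows split: if_splits)
  have "measure_pmf.prob ?P ?A = measure_pmf.prob ?P (?A \<inter> set_pmf ?P)"
    by (rule measure_Int_set_pmf[symmetric])
  also have "\<dots> \<le> measure_pmf.prob ?P (?A \<inter> (?S \<times> ?S))"
    using sup by (intro measure_pmf.finite_measure_mono) auto
  also have "\<dots> = (\<Sum>z\<in>?A \<inter> (?S \<times> ?S). pmf ?P z)"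
    using fin by (intro measure_measure_pmf_finite) auto
  also have "\<dots> \<le> (\<Sum>z\<in>?A \<inter> (?S \<times> ?S). pmf ?P z * (\<bar>X (fst z) (snd z)\<bar> / \<epsilon>))"
  proof (rule sum_mono)
    fix z assume "z \<in> ?A \<inter> (?S \<times> ?S)"
    then have "1 \<le> \<bar>X (fst z) (snd z)\<bar> / \<epsilon>" using \<epsilon> by auto
    from mult_left_mono[OF this pmf_nonneg[of ?P z]]
    show "pmf ?P z \<le> pmf ?P z * (\<bar>X (fst z) (snd z)\<bar> / \<epsilon>)" by simp
  qed
  also have "\<dots> \<le> (\<Sum>z\<in>?S \<times> ?S. pmf ?P z * (\<bar>X (fst z) (snd z)\<bar> / \<epsilon>))"
    using fin \<epsilon> by (intro sum_mono2) auto
  also have "\<dots> = (\<Sum>\<pi>\<in>?S. \<Sum>\<tau>\<in>?S. pmf (mallows n q) \<pi> * pmf (mallows n q') \<tau> * (\<bar>X \<pi> \<tau>\<bar> / \<epsilon>))"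
    unfolding sum.cartesian_product by (intro sum.cong) (auto simp: pmf_pair)
  also have "\<dots> = mallows_E n q (\<lambda>\<pi>. mallows_E n q' (\<lambda>\<tau>. \<bar>X \<pi> \<tau>\<bar>)) / \<epsilon>"
    unfolding mallows_E_def by (simp add: sum_distrib_left sum_divide_distrib mult_ac)
  finally show ?thesis .
qed

text \<open>Fix \<open>\<pi>\<close> and sum over \<open>j = \<pi> i\<close>: the law of large numbers for \<open>\<tau>\<close> replaces
\<open>f (i / n, \<tau> (\<pi> i) / n)\<close> by \<open>G (i / n, \<pi> i / n)\<close> with a continuous \<open>G\<close>, uniformly in
\<open>\<pi>\<close>. The same law for \<open>\<pi>\<close> replaces this by \<open>K (i / n, i / n)\<close>, and what is left is a Riemann
sum.\<close>

lemma composed_mallows_LLN: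
  fixes q q' :: "nat \<Rightarrow> real"
  assumes q: "\<And>n. n \<ge> 1 \<Longrightarrow> q n > 0" and q': "\<And>n. n \<ge> 1 \<Longrightarrow> q' n > 0"
    and lim: "(\<lambda>n. real n * (1 - q n)) \<longlonglongrightarrow> \<beta>" and lim': "(\<lambda>n. real n * (1 - q' n)) \<longlonglongrightarrow> \<gamma>"
    and f: "continuous_on unit_square f" and e: "e > 0"
  shows "\<forall>\<^sub>F n in sequentially. mallows_E n (q n) (\<lambda>\<pi>. mallows_E n (q' n) (\<lambda>\<tau>.
      \<bar>1 / n * (\<Sum>i=1..n. f (real i / n, real ((\<tau> \<circ> \<pi>) i) / n))
        - integral {0..1} (\<lambda>y. integral {0..1} (\<lambda>x. f (x, y) * mallows_rho \<beta> \<gamma> x y))\<bar>)) \<le> e"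
proof -
  define G where "G = mallows_average \<gamma> f"
  define K where "K = mallows_average \<beta> G"
  define I where "I = integral {0..1} (\<lambda>x. K (x, x))"
  have G: "continuous_on unit_square G" unfolding G_def by (rule continuous_on_mallows_average[OF f])
  have "continuous_on unit_square K" unfolding K_def by (rule continuous_on_mallows_average[OF G])
  then have K: "continuous_on {0..1} (\<lambda>x. K (x, x))"
    by (rule continuous_on_compose2) (auto intro!: continuous_intros)
  have e3: "e / 3 > 0" using e by simp
  have "\<forall>\<^sub>F n in sequentially. \<forall>x. (\<forall>j\<in>{1..n}. x j \<in> {0..1}) \<longrightarrow>
     mallows_E n (q' n) (\<lambda>p. \<bar>1 / n * (\<Sum>j=1..n. f (x j, real (p j) / n))
       - 1 / n * (\<Sum>j=1..n. G (x j, real j / n))\<bar>) \<le> e / 3"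
    using mallows_LLN_continuous[OF q' lim' f] e3 unfolding mallows_LLN_for_def G_def by blast
  moreover have "\<forall>\<^sub>F n in sequentially. \<forall>x. (\<forall>j\<in>{1..n}. x j \<in> {0..1}) \<longrightarrow>
     mallows_E n (q n) (\<lambda>p. \<bar>1 / n * (\<Sum>j=1..n. G (x j, real (p j) / n))
       - 1 / n * (\<Sum>j=1..n. K (x j, real j / n))\<bar>) \<le> e / 3"
    using mallows_LLN_continuous[OF q lim G] e3 unfolding mallows_LLN_for_def K_def by blast
  moreover have "\<forall>\<^sub>F n in sequentially. dist (1 / real n * (\<Sum>i=1..n. K (real i / n, real i / n))) I < e / 3"
    unfolding I_def by (intro tendstoD[OF right_Riemann_sum_tendsto[OF K]] e3)
  ultimately have "\<forall>\<^sub>F n in sequentially. mallows_E n (q n) (\<lambda>\<pi>. mallows_E n (q' n) (\<lambda>\<tau>.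
      \<bar>1 / n * (\<Sum>i=1..n. f (real i / n, real ((\<tau> \<circ> \<pi>) i) / n)) - I\<bar>)) \<le> e"
    using eventually_ge_at_top[of 1]
  proof eventually_elim
    case (elim n)
    have qn: "q n > 0" "q' n > 0" using q q' elim(4) by auto
    have unit: "real m / n \<in> {0..1}" if "m \<le> n" for m using that elim(4) by simp
    let ?F = "\<lambda>\<pi> \<tau>. 1 / n * (\<Sum>i=1..n. f (real i / n, real ((\<tau> \<circ> \<pi>) i) / n))"
    let ?G = "\<lambda>\<pi>. 1 / n * (\<Sum>i=1..n. G (real i / n, real (\<pi> i) / n))"
    let ?K = "1 / n * (\<Sum>i=1..n. K (real i / n, real i / n))"
    have "mallows_E n (q' n) (\<lambda>\<tau>. \<bar>?F \<pi> \<tau> - I\<bar>) \<le> \<bar>?G \<pi> - ?K\<bar> + 2 * e / 3"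
      if \<pi>: "\<pi> permutes {1..n}" for \<pi>
    proof -
      \<comment> \<open>Indexed by the value \<open>j = \<pi> i\<close>, the relative position \<open>i / n\<close> is a coordinate attached to the
      argument of \<open>\<tau>\<close>.\<close>
      define x where "x = (\<lambda>j. real (inv \<pi> j) / n)"
      have x: "x j \<in> {0..1}" if "j \<in> {1..n}" for j
        unfolding x_def using permutes_in_image[OF permutes_inv[OF \<pi>], of j] that by (intro unit) simp
      have reindex: "(\<Sum>j=1..n. h (x j) j) = (\<Sum>i=1..n. h (real i / n) (\<pi> i))" for h :: "real \<Rightarrow> nat \<Rightarrow> real"
        using sum.permute[OF \<pi>, of "\<lambda>j. h (x j) j"] permutes_inverses(2)[OF \<pi>]
        unfolding x_def by (simp add: o_def)
      have "mallows_E n (q' n) (\<lambda>\<tau>. \<bar>1 / n * (\<Sum>j=1..n. f (x j, real (\<tau> j) / n))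
          - 1 / n * (\<Sum>j=1..n. G (x j, real j / n))\<bar>) \<le> e / 3"
        using elim(1) x by blast
      then have F: "mallows_E n (q' n) (\<lambda>\<tau>. \<bar>?F \<pi> \<tau> - ?G \<pi>\<bar>) \<le> e / 3"
        using reindex[of "\<lambda>x j. f (x, real (\<tau> j) / n)" for \<tau>] reindex[of "\<lambda>x j. G (x, real j / n)"]
        by simp
      have "mallows_E n (q' n) (\<lambda>\<tau>. \<bar>?F \<pi> \<tau> - I\<bar>)
          \<le> mallows_E n (q' n) (\<lambda>\<tau>. \<bar>?F \<pi> \<tau> - ?G \<pi>\<bar> + (\<bar>?G \<pi> - ?K\<bar> + e / 3))"
      proof (rule mallows_E_mono)
        fix \<tau>
        have "\<bar>?K - I\<bar> < e / 3" using elim(3) by (simp add: dist_real_def)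
        then show "\<bar>?F \<pi> \<tau> - I\<bar> \<le> \<bar>?F \<pi> \<tau> - ?G \<pi>\<bar> + (\<bar>?G \<pi> - ?K\<bar> + e / 3)" by linarith
      qed
      also have "\<dots> = mallows_E n (q' n) (\<lambda>\<tau>. \<bar>?F \<pi> \<tau> - ?G \<pi>\<bar>) + (\<bar>?G \<pi> - ?K\<bar> + e / 3)"
        unfolding mallows_E_add[of _ _ _ "\<lambda>_. _ + _"] mallows_E_const[OF qn(2)] ..
      also have "\<dots> \<le> \<bar>?G \<pi> - ?K\<bar> + 2 * e / 3" using F by linarith
      finally show ?thesis .
    qed
    then have "mallows_E n (q n) (\<lambda>\<pi>. mallows_E n (q' n) (\<lambda>\<tau>. \<bar>?F \<pi> \<tau> - I\<bar>))
        \<le> mallows_E n (q n) (\<lambda>\<pi>. \<bar>?G \<pi> - ?K\<bar> + 2 * e / 3)"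
      by (rule mallows_E_mono)
    also have "\<dots> = mallows_E n (q n) (\<lambda>\<pi>. \<bar>?G \<pi> - ?K\<bar>) + 2 * e / 3"
      unfolding mallows_E_add mallows_E_const[OF qn(1)] ..
    also have "mallows_E n (q n) (\<lambda>\<pi>. \<bar>?G \<pi> - ?K\<bar>) \<le> e / 3"
      using elim(2)[rule_format, of "\<lambda>j. real j / n"] unit by simp
    finally show ?case by simp
  qed
  then show ?thesis
    unfolding I_def K_def G_def iterated_mallows_average_eq[OF f] .
qed

theorem theorem3:
  fixes q q' :: "nat \<Rightarrow> real" and \<beta> \<gamma> \<epsilon> :: real
    and f :: "real \<times> real \<Rightarrow> real"
  assumes "\<And>n. n \<ge> 1 \<Longrightarrow> q n > 0"
    and "\<And>n. n \<ge> 1 \<Longrightarrow> q' n > 0"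
    and "(\<lambda>n. real n * (1 - q n)) \<longlonglongrightarrow> \<beta>"
    and "(\<lambda>n. real n * (1 - q' n)) \<longlonglongrightarrow> \<gamma>"
    and "\<epsilon> > 0"
    and "continuous_on ({0..1} \<times> {0..1}) f"
  shows "(\<lambda>n. measure_pmf.prob (pair_pmf (mallows n (q n)) (mallows n (q' n)))
      {(\<pi>, \<tau>).
        \<bar>(1 / real n) * (\<Sum>i = 1..n. f (real i / real n, real ((\<tau> \<circ> \<pi>) i) / real n))
          - integral {0..1} (\<lambda>y. integral {0..1} (\<lambda>x. f (x, y) * mallows_rho \<beta> \<gamma> x y))\<bar> > \<epsilon>})
    \<longlonglongrightarrow> 0"
proof (rule tendstoI)
  fix e :: real assume e: "e > 0"
  let ?X = "\<lambda>n \<pi> \<tau>. (1 / real n) * (\<Sum>i = 1..n. f (real i / real n, real ((\<tau> \<circ> \<pi>) i) / real n))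
          - integral {0..1} (\<lambda>y. integral {0..1} (\<lambda>x. f (x, y) * mallows_rho \<beta> \<gamma> x y))"
  have "e * \<epsilon> / 2 > 0" using e assms(5) by simp
  then have "\<forall>\<^sub>F n in sequentially. mallows_E n (q n) (\<lambda>\<pi>. mallows_E n (q' n) (\<lambda>\<tau>.
      \<bar>?X n \<pi> \<tau>\<bar>)) \<le> e * \<epsilon> / 2"
    using assms by (intro composed_mallows_LLN) auto
  then show "\<forall>\<^sub>F n in sequentially. dist (measure_pmf.prob (pair_pmf (mallows n (q n)) (mallows n (q' n)))
      {(\<pi>, \<tau>). \<bar>?X n \<pi> \<tau>\<bar> > \<epsilon>}) 0 < e"
    using eventually_ge_at_top[of 1]
  proof eventually_elim
    case (elim n)
    have "measure_pmf.prob (pair_pmf (mallows n (q n)) (mallows n (q' n))) {(\<pi>, \<tau>). \<bar>?X n \<pi> \<tau>\<bar> > \<epsilon>}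
        \<le> mallows_E n (q n) (\<lambda>\<pi>. mallows_E n (q' n) (\<lambda>\<tau>. \<bar>?X n \<pi> \<tau>\<bar>)) / \<epsilon>"
      by (rule prob_pair_mallows_le[OF assms(1)[OF elim(2)] assms(2)[OF elim(2)] assms(5)])
    also have "\<dots> \<le> (e * \<epsilon> / 2) / \<epsilon>"
      using elim(1) assms(5) by (intro divide_right_mono) auto
    also have "\<dots> < e" using e assms(5) by simp
    finally show ?case by (simp add: dist_real_def)
  qed
qed

end
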